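(* Let $n\ge 1$, let $U,U'$ be domains in the Heisenberg group $\mathbb{H}^n$, and let $F:U\to U'$ be a conformal mapping which is $C^2$ smooth. Then $F$ is $C^\infty$ smooth.
   Context: The Heisenberg group $\mathbb{H}^n$ is $\mathbb{R}^{2n+1}=\mathbb{R}^n\times\mathbb{R}^n\times\mathbb{R}$ with the group law $(x,y,t)*(x',y',t')=(x+x',y+y',t+t'-2x\cdot y'+2x'\cdot y)$. A domain in $\mathbb{H}^n$ is a nonempty connected open subset; smoothness ($C^1$, $C^2$, $C^\infty$) is with respect to the standard smooth structure of $\mathbb{R}^{2n+1}$. Write $X_j=\frac{\partial}{\partial x_j}+2y_j\frac{\partial}{\partial t}$, $Y_j=\frac{\partial}{\partial y_j}-2x_j\frac{\partial}{\partial t}$ for $j=1,\ldots,n$ (left invariant vector fields), and set $x_{n+j}=y_j$, $X_{n+j}=Y_j$. The horizontal tangent space $H_p\mathbb{H}^n$ at $p$ is the span of $X_1,\ldots,X_{2n}$ at $p$. The standard contact form is $\alpha=dt+2\sum_{k=1}^n(x_k\,dx_{n+k}-x_{n+k}\,dx_k)$, so that $H_p\mathbb{H}^n=\operatorname{Ker}\alpha(p)$. A $C^1$ diffeomorphism $F:U\to U'$ between domains of $\mathbb{H}^n$ (a $C^1$ bijection with $C^1$ inverse) is contact if $F^*\alpha=\lambda_F\,\alpha$ for some nowhere vanishing real-valued function $\lambda_F$ on $U$; then $\lambda_F$ has constant sign on $U$, and it is a standing assumption that $\lambda_F>0$ everywhere in $U$. For a contact diffeomorphism the differential $\mathbf{D}F(p)$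 maps $H_p\mathbb{H}^n$ onto $H_{F(p)}\mathbb{H}^n$; its restriction is denoted $\mathbf{D}_0F(p)$ and is regarded as a $2n\times 2n$ matrix with respect to the frames $X_1,\ldots,X_{2n}$ at $p$ and at $F(p)$ (if $F=(f_1,\ldots,f_{2n+1})$ in coordinates, its $(k,\ell)$ entry is $X_\ell f_k(p)$, $1\le k,\ell\le 2n$). Put $J_0F=\det\mathbf{D}_0F$. A $C^1$ diffeomorphism $F:U\to U'$ between domains in $\mathbb{H}^n$ is conformal if $F$ is contact, $J_0F>0$, and $(\mathbf{D}_0F(p))^T\,\mathbf{D}_0F(p)=J_0F(p)^{1/n}\,\mathbf{I}_{2n}$ for all $p\in U$, where $\mathbf{I}_{2n}$ is the $2n\times 2n$ identity matrix. *)

theory Defs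
  imports "HOL-Analysis.Analysis"
begin

text \<open>Points (x, y, t) of the Heisenberg group of dimension 2n + 1, where n = CARD('n).\<close>

type_synonym 'n heis = "(real^'n) \<times> (real^'n) \<times> real"

definition heis_domain :: "('n::finite) heis set \<Rightarrow> bool" where
  "heis_domain U \<longleftrightarrow> open U \<and> connected U \<and> U \<noteq> {}"

text \<open>C^k smoothness on an open set: for k + 1, the Frechet derivative exists on the set and,
  for each fixed direction v, the map p \<mapsto> Df(p) v is C^k; these maps are the fixed linear
  combinations of the partial derivatives of f. Meant for open sets only, since all derivatives are
  taken in a full neighbourhood.\<close>

primrec Ck_on :: "nat \<Rightarrow> 'a set \<Rightarrow> ('a::real_normed_vector \<Rightarrow> 'b::real_normed_vector) \<Rightarrow> bool" where
  "Ck_on 0 U f \<longleftrightarrow> continuous_on U f"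
| "Ck_on (Suc k) U f \<longleftrightarrow>
     (\<forall>p\<in>U. f differentiable (at p)) \<and>
     (\<forall>v. Ck_on k U (\<lambda>p. frechet_derivative f (at p) v))"

definition Cinf_on :: "'a set \<Rightarrow> ('a::real_normed_vector \<Rightarrow> 'b::real_normed_vector) \<Rightarrow> bool" where
  "Cinf_on U f \<longleftrightarrow> (\<forall>k. Ck_on k U f)"

definition C1_diffeo ::
    "'a set \<Rightarrow> 'b set \<Rightarrow> ('a::real_normed_vector \<Rightarrow> 'b::real_normed_vector) \<Rightarrow> bool" where
  "C1_diffeo U U' F \<longleftrightarrow>
     bij_betw F U U' \<and> Ck_on 1 U F \<and> Ck_on 1 U' (the_inv_into U F)"

text \<open>The index set {1, ..., 2n} is the type \<open>'n + 'n\<close>: \<open>Inl j\<close> stands for j and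
  \<open>Inr j\<close> for n + j.\<close>

definition hcoord :: "'n + 'n \<Rightarrow> ('n::finite) heis \<Rightarrow> real" where
  "hcoord k p = (case p of (x, y, t) \<Rightarrow> case k of Inl j \<Rightarrow> x $ j | Inr j \<Rightarrow> y $ j)"

definition hframe :: "'n + 'n \<Rightarrow> ('n::finite) heis \<Rightarrow> 'n heis" where
  "hframe k p = (case p of (x, y, t) \<Rightarrow>
     case k of Inl j \<Rightarrow> (axis j 1, 0, 2 * y $ j) | Inr j \<Rightarrow> (0, axis j 1, - 2 * x $ j))"

definition hderiv :: "'n + 'n \<Rightarrow> (('n::finite) heis \<Rightarrow> real) \<Rightarrow> 'n heis \<Rightarrow> real" where
  "hderiv l f p = frechet_derivative f (at p) (hframe l p)"

text \<open>The contact form at p evaluated on a tangent vector (a, b, c).\<close>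

definition contact_form :: "('n::finite) heis \<Rightarrow> 'n heis \<Rightarrow> real" where
  "contact_form p v = (case p of (x, y, t) \<Rightarrow> case v of (a, b, c) \<Rightarrow>
     c + 2 * (\<Sum>k\<in>UNIV. x $ k * b $ k - y $ k * a $ k))"

definition pullback_form ::
    "(('n::finite) heis \<Rightarrow> 'n heis) \<Rightarrow> ('n heis \<Rightarrow> 'n heis \<Rightarrow> real) \<Rightarrow> 'n heis \<Rightarrow> 'n heis \<Rightarrow> real" where
  "pullback_form F \<omega> p v = \<omega> (F p) (frechet_derivative F (at p) v)"

text \<open>The factor lam is taken positive, not merely nonvanishing: this is a standing convention
  for contact maps.\<close>

definition contact_diffeo ::
    "('n::finite) heis set \<Rightarrow> 'n heis set \<Rightarrow> ('n heis \<Rightarrow> 'n heis) \<Rightarrow> bool" where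
  "contact_diffeo U U' F \<longleftrightarrow>
     C1_diffeo U U' F \<and>
     (\<exists>lam. \<forall>p\<in>U. lam p > 0 \<and> (\<forall>v. pullback_form F contact_form p v = lam p * contact_form p v))"

text \<open>For contact F, \<open>DF(p)\<close> maps \<open>hframe l p\<close> to the combination of the vectors
  \<open>hframe k (F p)\<close> with coefficients \<open>hderiv l f_k p\<close>, so this is the matrix of
  \<open>DF(p)\<close> restricted to the horizontal space, in the frames at p and at \<open>F p\<close>.\<close>

definition D0 :: "(('n::finite) heis \<Rightarrow> 'n heis) \<Rightarrow> 'n heis \<Rightarrow> real^('n + 'n)^('n + 'n)" where
  "D0 F p = (\<chi> k l. hderiv l (\<lambda>q. hcoord k (F q)) p)"

definition J0 :: "(('n::finite) heis \<Rightarrow> 'n heis) \<Rightarrow> 'n heis \<Rightarrow> real" where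
  "J0 F p = det (D0 F p)"

definition conformal_map ::
    "('n::finite) heis set \<Rightarrow> 'n heis set \<Rightarrow> ('n heis \<Rightarrow> 'n heis) \<Rightarrow> bool" where
  "conformal_map U U' F \<longleftrightarrow>
     contact_diffeo U U' F \<and>
     (\<forall>p\<in>U. J0 F p > 0 \<and>
       transpose (D0 F p) ** D0 F p = (J0 F p powr (1 / real CARD('n))) *\<^sub>R mat 1)"

end

theory Submission
  imports Defs
begin

text \<open>Put \<open>w j = f j + i f (n + j)\<close>, where \<open>f\<close> are the coordinates of \<open>F\<close>, and write
  \<open>Zd k = (X k - i Y k) / 2\<close> and \<open>Zb k = (X k + i Y k) / 2\<close>. On the horizontal spaces the
  differential of a conformal map is symplectic up to the factor \<open>lam\<close> of the contact form, and
  orthogonal up to another positive factor. A real matrix with both properties is complex linear and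
  the two factors agree (lemma \<open>conformal_symplectic_frame\<close>). Hence every \<open>w j\<close> is a CR function,
  \<open>Zb k (w j) = 0\<close>, and the matrix \<open>b j k = X k (w j)\<close> is a unitary matrix times the square
  root of \<open>lam\<close>.

  CR functions need not be smooth. What makes the map smooth is that the whole system is of finite
  type. Let \<open>\<gamma> k = (i/2) Zb k (ln lam)\<close>, \<open>\<tau> = T (ln lam)\<close>, \<open>N\<close> the sum of the
  squares \<open>|\<gamma> k|^2\<close>, and \<open>\<rho> = \<tau>/2 - i N\<close>. Differentiating the relations above along the
  fields and using the commutators \<open>[X k, Y k] = -4 T\<close> one finds, with \<open>T (w j) = (\<Sum>k. b j k \<gamma> k)\<close>,

  \<^item> \<open>Zd m (b j l) = 2 i (b j l cnj (\<gamma> m) + b j m cnj (\<gamma> l))\<close> and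
    \<open>Zb m (b j l) = 2 i T (w j)\<close> if \<open>m = l\<close>, and \<open>0\<close> otherwise;
  \<^item> \<open>Zb m (\<gamma> k) = -2 i \<gamma> m \<gamma> k\<close>, \<open>Zd m (\<gamma> k) = \<rho>\<close> if \<open>m = k\<close> and \<open>0\<close> otherwise,
    \<open>T (\<gamma> k) = \<gamma> k \<rho>\<close>;
  \<^item> \<open>Zd k \<rho> = 0\<close>, \<open>Zb k \<rho> = -2 i \<gamma> k \<rho>\<close>, \<open>T \<rho> = \<rho>^2\<close>.

  So all first derivatives of \<open>w\<close>, \<open>b\<close>, \<open>\<gamma>\<close>, \<open>\<tau>\<close> are polynomials in these functions
  and their conjugates, and if the functions are C^m then they are C^(m+1)
  (lemma \<open>structure_functions_Ck\<close>). The last coordinate of \<open>F\<close> follows from the contact equation.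

  For a map that is only C^2 the difficulty is that the equations involve three derivatives of
  \<open>w\<close> and that \<open>\<tau>\<close> is at first only continuous. Two facts overcome it. By contactness
  \<open>\<gamma>\<close> is a polynomial in first derivatives of \<open>w\<close> and their conjugates, divided by
  \<open>lam\<close>, so it is C^1, and the
  horizontal derivatives of \<open>lam\<close> are C^1 although \<open>lam\<close> is defined by first derivatives of
  \<open>F\<close>. And the commutator formula holds at low regularity, in the form of the theorem of Schwarz:
  if \<open>f\<close> and \<open>V f\<close> are C^1, then \<open>V (W f)\<close> exists and equals \<open>W (V f) + [V, W] f\<close>
  (lemma \<open>lie_commutator\<close>), with a variant for \<open>V = T\<close> that
  asks less of \<open>T f\<close> (lemma \<open>lie_commute_T\<close>). These give the derivatives of \<open>\<tau>\<close> along all fields.\<close>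

section \<open>Mixed and partial derivatives\<close>

lemma mean_value_linearization:
  fixes h :: "real \<Rightarrow> 'b::real_normed_vector"
  assumes h: "\<And>x. x \<in> closed_segment a b \<Longrightarrow> (h has_vector_derivative h' x) (at x)"
    and B: "\<And>x. x \<in> closed_segment a b \<Longrightarrow> norm (h' x - M) \<le> B"
  shows "norm (h b - h a - (b - a) *\<^sub>R M) \<le> B * \<bar>b - a\<bar>"
proof -
  have "norm ((h b - b *\<^sub>R M) - (h a - a *\<^sub>R M)) \<le> B * norm (b - a)"
  proof (rule differentiable_bound[of "closed_segment a b" _ "\<lambda>x t. t *\<^sub>R (h' x - M)"])
    fix x assume x: "x \<in> closed_segment a b"
    have "((\<lambda>x. h x - x *\<^sub>R M) has_vector_derivative h' x - M) (at x)"
      by (auto intro!: derivative_eq_intros h x)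
    then show "((\<lambda>x. h x - x *\<^sub>R M) has_derivative (\<lambda>t. t *\<^sub>R (h' x - M)))
        (at x within closed_segment a b)"
      unfolding has_vector_derivative_def by (rule has_derivative_at_withinI)
    have "onorm (\<lambda>t::real. t *\<^sub>R (h' x - M)) = norm (h' x - M)"
      using onorm_scaleR_left[OF bounded_linear_ident, of "h' x - M"] by (simp add: onorm_id)
    then show "onorm (\<lambda>t. t *\<^sub>R (h' x - M)) \<le> B" using B[OF x] by simp
  qed auto
  then show ?thesis by (simp add: algebra_simps)
qed

text \<open>The theorem of Schwarz in Peano's form: existence and continuity of one mixed derivative
  suffice for the existence of the other. Both equal the limit of the second difference quotients;
  two applications of the mean value theorem compare these with the mixed derivative at the
  origin, uniformly in \<open>r\<close>, and
  then \<open>r\<close> may tend to zero.\<close>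

lemma mixed_derivative_commute:
  fixes \<Phi> \<Phi>1 \<Phi>12 :: "real \<Rightarrow> real \<Rightarrow> 'b::real_normed_vector"
  assumes "e > 0"
    and d1: "\<And>s r. \<bar>s\<bar> < e \<Longrightarrow> \<bar>r\<bar> < e \<Longrightarrow> ((\<lambda>s. \<Phi> s r) has_vector_derivative \<Phi>1 s r) (at s)"
    and d12: "\<And>s r. \<bar>s\<bar> < e \<Longrightarrow> \<bar>r\<bar> < e \<Longrightarrow> (\<Phi>1 s has_vector_derivative \<Phi>12 s r) (at r)"
    and d2: "\<And>s. \<bar>s\<bar> < e \<Longrightarrow> (\<Phi> s has_vector_derivative \<Phi>2 s) (at 0)"
    and c: "isCont (\<lambda>x. \<Phi>12 (fst x) (snd x)) (0, 0)"
  shows "(\<Phi>2 has_vector_derivative \<Phi>12 0 0) (at 0)"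
proof -
  define M where "M = \<Phi>12 0 0"
  have "\<exists>d>0. \<forall>s. norm (s - 0) < d \<longrightarrow> norm (\<Phi>2 s - \<Phi>2 0 - (s - 0) *\<^sub>R M) \<le> \<epsilon> * norm (s - 0)"
    if "\<epsilon> > 0" for \<epsilon>
  proof -
    obtain d0 where d0: "d0 > 0"
      "\<And>x. dist x (0,0) < d0 \<Longrightarrow> dist (\<Phi>12 (fst x) (snd x)) M < \<epsilon>"
      using c \<open>\<epsilon> > 0\<close> unfolding continuous_at_eps_delta M_def by fastforce
    define d where "d = min e (d0/2)"
    have d: "d > 0" "d \<le> e" using \<open>e > 0\<close> d0(1) by (auto simp: d_def)
    have M: "norm (\<Phi>12 s r - M) \<le> \<epsilon>" if "\<bar>s\<bar> < d" "\<bar>r\<bar> < d" for s r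
    proof -
      have "dist (s, r) (0, 0) \<le> \<bar>s\<bar> + \<bar>r\<bar>"
        using norm_Pair_le[of s r] by (simp add: dist_norm norm_prod_def)
      also have "\<dots> < d0" using that by (auto simp: d_def)
      finally show ?thesis using d0(2)[of "(s,r)"] by (simp add: dist_norm)
    qed
    have r: "norm (\<Phi>1 s r - \<Phi>1 s 0 - r *\<^sub>R M) \<le> \<epsilon> * \<bar>r\<bar>" if "\<bar>s\<bar> < d" "\<bar>r\<bar> < d" for s r
      using mean_value_linearization[of 0 r "\<Phi>1 s" "\<Phi>12 s" M \<epsilon>] d12 M that d
      by (force simp: closed_segment_eq_real_ivl split: if_splits)
    have q: "norm (\<Phi> s r - \<Phi> s 0 - (\<Phi> 0 r - \<Phi> 0 0) - (s * r) *\<^sub>R M) \<le> \<epsilon> * \<bar>r\<bar> * \<bar>s\<bar>"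
      if "\<bar>s\<bar> < d" "\<bar>r\<bar> < d" for s r
    proof -
      have s: "\<bar>x\<bar> < d" if "x \<in> closed_segment 0 s" for x
        using that \<open>\<bar>s\<bar> < d\<close> by (auto simp: closed_segment_eq_real_ivl split: if_splits)
      have "((\<lambda>s. \<Phi> s r - \<Phi> s 0) has_vector_derivative \<Phi>1 x r - \<Phi>1 x 0) (at x)"
        if "x \<in> closed_segment 0 s" for x
        using s[OF that] \<open>\<bar>r\<bar> < d\<close> d by (intro derivative_intros d1) auto
      then show ?thesis
        using mean_value_linearization[of 0 s "\<lambda>s. \<Phi> s r - \<Phi> s 0" "\<lambda>s. \<Phi>1 s r - \<Phi>1 s 0" "r *\<^sub>R M"
            "\<epsilon> * \<bar>r\<bar>"] r s that
        by (simp add: algebra_simps)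
    qed
    have "norm (\<Phi>2 s - \<Phi>2 0 - s *\<^sub>R M) \<le> \<epsilon> * \<bar>s\<bar>" if s: "\<bar>s\<bar> < d" for s
    proof (rule field_le_epsilon)
      fix \<eta> :: real assume "\<eta> > 0"
      have "\<exists>\<delta>>0. \<forall>r. \<bar>r\<bar> < \<delta> \<longrightarrow> norm (\<Phi> s r - \<Phi> s 0 - r *\<^sub>R \<Phi>2 s) \<le> \<eta>/2 * \<bar>r\<bar>" if "\<bar>s\<bar> < e" for s
        using d2[OF that] \<open>\<eta> > 0\<close> unfolding has_vector_derivative_def has_derivative_at_alt
        by (elim conjE allE[of _ "\<eta>/2"]) auto
      note lim = this
      obtain \<delta>1 where \<delta>1: "\<delta>1 > 0"
        "\<And>r. \<bar>r\<bar> < \<delta>1 \<Longrightarrow> norm (\<Phi> s r - \<Phi> s 0 - r *\<^sub>R \<Phi>2 s) \<le> \<eta>/2 * \<bar>r\<bar>"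
        using lim[of s] s d by auto
      obtain \<delta>2 where \<delta>2: "\<delta>2 > 0"
        "\<And>r. \<bar>r\<bar> < \<delta>2 \<Longrightarrow> norm (\<Phi> 0 r - \<Phi> 0 0 - r *\<^sub>R \<Phi>2 0) \<le> \<eta>/2 * \<bar>r\<bar>"
        using lim[of 0] \<open>e > 0\<close> by auto
      define r where "r = min d (min \<delta>1 \<delta>2) / 2"
      have r: "r > 0" "r < d" "r < \<delta>1" "r < \<delta>2" using \<delta>1(1) \<delta>2(1) d by (auto simp: r_def)
      have e: "r *\<^sub>R (\<Phi>2 s - \<Phi>2 0 - s *\<^sub>R M) =
          (\<Phi> s r - \<Phi> s 0 - (\<Phi> 0 r - \<Phi> 0 0) - (s * r) *\<^sub>R M)
          - (\<Phi> s r - \<Phi> s 0 - r *\<^sub>R \<Phi>2 s) + (\<Phi> 0 r - \<Phi> 0 0 - r *\<^sub>R \<Phi>2 0)"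
        by (simp add: algebra_simps)
      have "r * norm (\<Phi>2 s - \<Phi>2 0 - s *\<^sub>R M) = norm (r *\<^sub>R (\<Phi>2 s - \<Phi>2 0 - s *\<^sub>R M))"
        using r by simp
      also have "\<dots> \<le> \<epsilon> * \<bar>r\<bar> * \<bar>s\<bar> + \<eta>/2 * \<bar>r\<bar> + \<eta>/2 * \<bar>r\<bar>"
        unfolding e using q[OF s, of r] \<delta>1(2)[of r] \<delta>2(2)[of r] r
        by (intro norm_triangle_le[OF add_mono[OF norm_triangle_le_diff[OF add_mono]]]) simp_all
      also have "\<dots> = r * (\<epsilon> * \<bar>s\<bar> + \<eta>)" using r by (simp add: algebra_simps)
      finally show "norm (\<Phi>2 s - \<Phi>2 0 - s *\<^sub>R M) \<le> \<epsilon> * \<bar>s\<bar> + \<eta>" using r by simp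
    qed
    then show ?thesis using d by auto
  qed
  then show ?thesis
    unfolding has_vector_derivative_def has_derivative_at_alt M_def
    by (simp add: bounded_linear_scaleR_left)
qed

text \<open>Go from \<open>x\<close> to \<open>x + v\<close> along one coordinate direction after the other, and use the mean
  value theorem on each of these segments.\<close>

lemma has_derivative_from_partials:
  fixes f :: "'a::euclidean_space \<Rightarrow> 'b::real_normed_vector"
  assumes "open U" "x \<in> U"
    and d: "\<And>y b. y \<in> U \<Longrightarrow> b \<in> Basis \<Longrightarrow> ((\<lambda>s. f (y + s *\<^sub>R b)) has_vector_derivative G b y) (at 0)"
    and c: "\<And>b. b \<in> Basis \<Longrightarrow> continuous_on U (G b)"
  shows "(f has_derivative (\<lambda>v. \<Sum>b\<in>Basis. (v \<bullet> b) *\<^sub>R G b x)) (at x)"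
  unfolding has_derivative_at_alt
proof (intro conjI allI impI)
  show "bounded_linear (\<lambda>v. \<Sum>b\<in>Basis. (v \<bullet> b) *\<^sub>R G b x)"
    by (intro bounded_linear_sum bounded_linear_scaleR_const bounded_linear_inner_left)
next
  fix \<epsilon> :: real assume "\<epsilon> > 0"
  define n where "n = real DIM('a)"
  have n: "n \<ge> 1" by (simp add: n_def DIM_positive Suc_leI)
  define e where "e = \<epsilon> / n"
  have e: "e > 0" using \<open>\<epsilon> > 0\<close> n by (simp add: e_def)
  have "\<exists>d>0. \<forall>y. dist y x < d \<longrightarrow> y \<in> U \<and> norm (G b y - G b x) \<le> e" if "b \<in> Basis" for b
  proof -
    have "isCont (G b) x" using c[OF that] assms continuous_on_eq_continuous_at by blast
    then obtain d1 where d1: "d1 > 0" "\<And>y. dist y x < d1 \<Longrightarrow> dist (G b y) (G b x) < e"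
      using e unfolding continuous_at_eps_delta by blast
    obtain d2 where d2: "d2 > 0" "\<And>y. dist y x < d2 \<Longrightarrow> y \<in> U"
      using assms(1,2) unfolding open_dist by blast
    have "y \<in> U \<and> norm (G b y - G b x) \<le> e" if "dist y x < min d1 d2" for y
      using d1(2)[of y] d2(2)[of y] that by (simp add: dist_norm)
    then show ?thesis using d1(1) d2(1) by (intro exI[of _ "min d1 d2"]) simp
  qed
  then obtain \<delta> where \<delta>: "\<And>b. b \<in> Basis \<Longrightarrow> \<delta> b > 0"
    "\<And>b y. b \<in> Basis \<Longrightarrow> dist y x < \<delta> b \<Longrightarrow> y \<in> U \<and> norm (G b y - G b x) \<le> e" by metis
  define d where "d = Min (\<delta> ` Basis)"
  have d: "d > 0" "\<And>b y. b \<in> Basis \<Longrightarrow> dist y x < d \<Longrightarrow> y \<in> U \<and> norm (G b y - G b x) \<le> e"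
    using \<delta> by (auto simp: d_def)
  show "\<exists>d>0. \<forall>y. norm (y - x) < d \<longrightarrow>
      norm (f y - f x - (\<Sum>b\<in>Basis. ((y - x) \<bullet> b) *\<^sub>R G b x)) \<le> \<epsilon> * norm (y - x)"
  proof (intro exI[of _ "d/n"] conjI allI impI)
    show "d/n > 0" using d n by simp
    fix y assume y: "norm (y - x) < d/n"
    define v where "v = y - x"
    have v: "(\<Sum>b\<in>Basis. \<bar>v \<bullet> b\<bar>) \<le> n * norm v"
      using sum_bounded_above[of Basis "\<lambda>b. \<bar>v \<bullet> b\<bar>" "norm v"] by (simp add: Basis_le_norm n_def)
    then have vd: "(\<Sum>b\<in>Basis. \<bar>v \<bullet> b\<bar>) < d"
      using y n by (simp add: v_def pos_less_divide_eq mult.commute)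
    have "norm (f (x + (\<Sum>b\<in>S. (v \<bullet> b) *\<^sub>R b)) - f x - (\<Sum>b\<in>S. (v \<bullet> b) *\<^sub>R G b x)) \<le> e * (\<Sum>b\<in>S. \<bar>v \<bullet> b\<bar>)"
      if "S \<subseteq> Basis" for S
    proof -
      have "finite S" using that by (rule finite_subset) simp
      then show ?thesis using that
      proof (induction S rule: finite_induct)
        case (insert a S)
        define y where "y = x + (\<Sum>b\<in>S. (v \<bullet> b) *\<^sub>R b)"
        have near: "dist (y + s *\<^sub>R a) x < d" if "s \<in> closed_segment 0 (v \<bullet> a)" for s
        proof -
          have "norm (\<Sum>b\<in>S. (v \<bullet> b) *\<^sub>R b) \<le> (\<Sum>b\<in>S. \<bar>v \<bullet> b\<bar>)"
            by (rule sum_norm_le) (use insert in auto)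
          moreover have "norm (s *\<^sub>R a) \<le> \<bar>v \<bullet> a\<bar>"
            using that insert by (auto simp: closed_segment_eq_real_ivl split: if_splits)
          ultimately have "dist (y + s *\<^sub>R a) x \<le> (\<Sum>b\<in>insert a S. \<bar>v \<bullet> b\<bar>)"
            using insert norm_triangle_ineq[of "\<Sum>b\<in>S. (v \<bullet> b) *\<^sub>R b" "s *\<^sub>R a"]
            by (simp add: y_def dist_norm)
          also have "\<dots> \<le> (\<Sum>b\<in>Basis. \<bar>v \<bullet> b\<bar>)" by (rule sum_mono2) (use insert in auto)
          finally show ?thesis using vd by simp
        qed
        have a: "((\<lambda>s. f (y + s *\<^sub>R a)) has_vector_derivative G a (y + s *\<^sub>R a)) (at s)"
          if "s \<in> closed_segment 0 (v \<bullet> a)" for s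
        proof -
          have "y + s *\<^sub>R a \<in> U" using near[OF that] d(2) insert by blast
          then have "((\<lambda>t. f (y + s *\<^sub>R a + t *\<^sub>R a)) has_vector_derivative G a (y + s *\<^sub>R a)) (at (s - s))"
            using assms(3) insert by simp
          moreover have "((\<lambda>t. t - s) has_vector_derivative 1) (at s)"
            by (auto intro!: derivative_eq_intros)
          ultimately show ?thesis
            using vector_diff_chain_at[where f="\<lambda>t. t - s"] by (fastforce simp: o_def algebra_simps)
        qed
        have "norm (f (y + (v \<bullet> a) *\<^sub>R a) - f (y + 0 *\<^sub>R a) - (v \<bullet> a - 0) *\<^sub>R G a x) \<le> e * \<bar>v \<bullet> a - 0\<bar>"
          by (rule mean_value_linearization[of 0 "v \<bullet> a" "\<lambda>s. f (y + s *\<^sub>R a)" "\<lambda>s. G a (y + s *\<^sub>R a)"])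
            (use a near d(2) insert in auto)
        moreover have "norm (f y - f x - (\<Sum>b\<in>S. (v \<bullet> b) *\<^sub>R G b x)) \<le> e * (\<Sum>b\<in>S. \<bar>v \<bullet> b\<bar>)"
          using insert by (simp add: y_def)
        ultimately show ?case
          using insert norm_triangle_ineq[of "f y - f x - (\<Sum>b\<in>S. (v \<bullet> b) *\<^sub>R G b x)"
              "f (y + (v \<bullet> a) *\<^sub>R a) - f y - (v \<bullet> a) *\<^sub>R G a x"]
          by (simp add: y_def algebra_simps)
      qed simp
    qed
    from this[of Basis]
    have "norm (f y - f x - (\<Sum>b\<in>Basis. (v \<bullet> b) *\<^sub>R G b x)) \<le> e * (\<Sum>b\<in>Basis. \<bar>v \<bullet> b\<bar>)"
      by (simp add: euclidean_representation v_def)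
    also have "\<dots> \<le> e * (n * norm v)" using v e by simp
    also have "\<dots> = \<epsilon> * norm v" using n by (simp add: e_def)
    finally show "norm (f y - f x - (\<Sum>b\<in>Basis. ((y - x) \<bullet> b) *\<^sub>R G b x)) \<le> \<epsilon> * norm (y - x)"
      by (simp add: v_def)
  qed
qed

section \<open>Calculus of the classes C^k\<close>

lemma Ck_on_cong:
  assumes "open U" "\<And>p. p \<in> U \<Longrightarrow> f p = g p" "Ck_on k U f"
  shows "Ck_on k U g"
  using assms(2,3)
proof (induction k arbitrary: f g)
  case 0
  then show ?case using continuous_on_cong[of U U f g] by simp
next
  case (Suc k)
  have d: "g differentiable (at p)" "frechet_derivative f (at p) = frechet_derivative g (at p)"
    if "p \<in> U" for p
  proof -
    have f: "f differentiable (at p)" using Suc that by simp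
    then obtain D where D: "(f has_derivative D) (at p)" by (auto simp: differentiable_def)
    have "(g has_derivative D) (at p)"
      by (rule has_derivative_transform_within_open[OF D assms(1) that]) (simp add: Suc)
    then show "g differentiable (at p)" by (auto simp: differentiable_def)
    show "frechet_derivative f (at p) = frechet_derivative g (at p)"
      using frechet_derivative_transform_within_open[OF f assms(1) that] Suc by simp
  qed
  have "Ck_on k U (\<lambda>p. frechet_derivative g (at p) v)" for v
    by (rule Suc.IH[of "\<lambda>p. frechet_derivative f (at p) v"]) (use d Suc in auto)
  with d show ?case by simp
qed

lemma Ck_on_SucD: "Ck_on (Suc k) U f \<Longrightarrow> Ck_on k U f"
proof (induction k arbitrary: f)
  case 0
  then show ?case
    by (auto intro!: continuous_at_imp_continuous_on differentiable_imp_continuous_within)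
next
  case (Suc k)
  then show ?case by (metis Ck_on.simps(2))
qed

lemma Ck_on_const [simp, intro]: "Ck_on k U (\<lambda>p. c)"
  by (induction k arbitrary: c) auto

lemma Ck_on_add:
  assumes "open U" "Ck_on k U f" "Ck_on k U g"
  shows "Ck_on k U (\<lambda>p. f p + g p)"
  using assms(2,3)
proof (induction k arbitrary: f g)
  case 0
  then show ?case by (auto intro: continuous_intros)
next
  case (Suc k)
  have d: "((\<lambda>p. f p + g p) has_derivative
      (\<lambda>v. frechet_derivative f (at p) v + frechet_derivative g (at p) v)) (at p)"
    if "p \<in> U" for p
    using Suc.prems that
    by (auto intro!: has_derivative_add simp flip: frechet_derivative_works)
  have "Ck_on k U (\<lambda>p. frechet_derivative (\<lambda>p. f p + g p) (at p) v)" for v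
  proof (rule Ck_on_cong[OF assms(1)])
    show "Ck_on k U (\<lambda>p. frechet_derivative f (at p) v + frechet_derivative g (at p) v)"
      using Suc by simp
  qed (simp add: frechet_derivative_at[OF d, symmetric])
  with d show ?case by (auto simp: differentiable_def)
qed

lemma Ck_on_bilinear:
  assumes "bounded_bilinear B" "open U" "Ck_on k U f" "Ck_on k U g"
  shows "Ck_on k U (\<lambda>p. B (f p) (g p))"
  using assms(3,4)
proof (induction k arbitrary: f g)
  case 0
  then show ?case using bounded_bilinear.continuous_on[OF assms(1)] by auto
next
  case (Suc k)
  have d: "((\<lambda>p. B (f p) (g p)) has_derivative
      (\<lambda>v. B (f p) (frechet_derivative g (at p) v) + B (frechet_derivative f (at p) v) (g p))) (at p)"
    if "p \<in> U" for p
    using Suc.prems that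
    by (auto intro!: bounded_bilinear.FDERIV[OF assms(1)] simp flip: frechet_derivative_works)
  have "Ck_on k U (\<lambda>p. frechet_derivative (\<lambda>p. B (f p) (g p)) (at p) v)" for v
  proof (rule Ck_on_cong[OF assms(2)])
    show "Ck_on k U (\<lambda>p. B (f p) (frechet_derivative g (at p) v)
        + B (frechet_derivative f (at p) v) (g p))"
      using Suc.prems Ck_on_SucD[OF Suc.prems(1)] Ck_on_SucD[OF Suc.prems(2)]
      by (intro Ck_on_add assms(2) Suc.IH) auto
  qed (simp add: frechet_derivative_at[OF d, symmetric])
  with d show ?case by (auto simp: differentiable_def)
qed

lemma Ck_on_linear:
  assumes "bounded_linear h" "open U" "Ck_on k U f"
  shows "Ck_on k U (\<lambda>p. h (f p))"
  using assms(3)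
proof (induction k arbitrary: f)
  case 0
  then show ?case using bounded_linear.continuous_on[OF assms(1)] by auto
next
  case (Suc k)
  have d: "((\<lambda>p. h (f p)) has_derivative (\<lambda>v. h (frechet_derivative f (at p) v))) (at p)"
    if "p \<in> U" for p
    using Suc.prems that
    by (auto intro!: bounded_linear.has_derivative[OF assms(1)] simp flip: frechet_derivative_works)
  have "Ck_on k U (\<lambda>p. frechet_derivative (\<lambda>p. h (f p)) (at p) v)" for v
  proof (rule Ck_on_cong[OF assms(2)])
    show "Ck_on k U (\<lambda>p. h (frechet_derivative f (at p) v))"
      using Suc by simp
  qed (simp add: frechet_derivative_at[OF d, symmetric])
  with d show ?case by (auto simp: differentiable_def)
qed

lemmas Ck_on_mult = Ck_on_bilinear[OF bounded_bilinear_mult]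
  and Ck_on_scaleR = Ck_on_bilinear[OF bounded_bilinear_scaleR]
  and Ck_on_cnj = Ck_on_linear[OF bounded_linear_cnj]
  and Ck_on_Re = Ck_on_linear[OF bounded_linear_Re]
  and Ck_on_Im = Ck_on_linear[OF bounded_linear_Im]
  and Ck_on_of_real = Ck_on_linear[OF bounded_linear_of_real]
  and Ck_on_minus = Ck_on_linear[OF bounded_linear_minus[OF bounded_linear_ident]]

lemma Ck_on_diff:
  assumes "open U" "Ck_on k U f" "Ck_on k U g"
  shows "Ck_on k U (\<lambda>p. f p - g p)"
  using Ck_on_add[OF assms(1,2) Ck_on_minus[OF assms(1,3)]] by simp

lemma Ck_on_sum:
  assumes "open U" "\<And>j. j \<in> S \<Longrightarrow> Ck_on k U (f j)"
  shows "Ck_on k U (\<lambda>p. \<Sum>j\<in>S. f j p)"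
  using assms(2) by (induction S rule: infinite_finite_induct) (auto intro: Ck_on_add[OF assms(1)])

lemma Ck_on_power:
  fixes f :: "'a::real_normed_vector \<Rightarrow> 'b::real_normed_algebra_1"
  assumes "open U" "Ck_on k U f"
  shows "Ck_on k U (\<lambda>p. f p ^ m)"
  by (induction m) (auto intro: Ck_on_mult assms)

lemma Ck_on_inverse:
  fixes f :: "'a::real_normed_vector \<Rightarrow> 'b::real_normed_field"
  assumes "open U" "\<And>p. p \<in> U \<Longrightarrow> f p \<noteq> 0" "Ck_on k U f"
  shows "Ck_on k U (\<lambda>p. inverse (f p))"
  using assms(3)
proof (induction k)
  case 0
  then show ?case using assms by (auto intro!: continuous_intros)
next
  case (Suc k)
  have d: "((\<lambda>p. inverse (f p)) has_derivative
      (\<lambda>v. - (inverse (f p) * frechet_derivative f (at p) v * inverse (f p)))) (at p)"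
    if "p \<in> U" for p
    using Suc.prems that assms(2)[OF that]
    by (auto intro!: has_derivative_inverse simp flip: frechet_derivative_works)
  have i: "Ck_on k U (\<lambda>p. inverse (f p))"
    using Suc Ck_on_SucD by blast
  have "Ck_on k U (\<lambda>p. frechet_derivative (\<lambda>p. inverse (f p)) (at p) v)" for v
  proof (rule Ck_on_cong[OF assms(1)])
    show "Ck_on k U (\<lambda>p. - (inverse (f p) * frechet_derivative f (at p) v * inverse (f p)))"
      using Suc.prems by (intro Ck_on_minus Ck_on_mult assms(1) i) auto
  qed (simp add: frechet_derivative_at[OF d, symmetric])
  with d show ?case by (auto simp: differentiable_def)
qed

lemmas Ck_on_intros = Ck_on_add Ck_on_diff Ck_on_minus Ck_on_mult Ck_on_scaleR Ck_on_cnj Ck_on_Re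
  Ck_on_Im Ck_on_of_real Ck_on_sum Ck_on_power

section \<open>Left invariant fields and derivatives along them\<close>

text \<open>\<open>None\<close> stands for \<open>T\<close>, the derivative in the last coordinate, and \<open>Some l\<close> for the
  horizontal fields.\<close>

definition lfield :: "('n + 'n) option \<Rightarrow> ('n::finite) heis \<Rightarrow> 'n heis" where
  "lfield i p = (case i of None \<Rightarrow> (0, 0, 1) | Some l \<Rightarrow> hframe l p)"

text \<open>The structure constants: the commutator of the fields \<open>i\<close> and \<open>j\<close> is
  \<open>bracket i j\<close> times \<open>T\<close>.\<close>

definition bracket :: "('n + 'n) option \<Rightarrow> ('n + 'n) option \<Rightarrow> real" where
  "bracket i j = (case (i, j) of
     (Some (Inl a), Some (Inr b)) \<Rightarrow> if a = b then -4 else 0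
   | (Some (Inr a), Some (Inl b)) \<Rightarrow> if a = b then 4 else 0
   | _ \<Rightarrow> 0)"

lemma bracket_simps [simp]:
  "bracket None j = 0" "bracket i None = 0"
  "bracket (Some (Inl a)) (Some (Inl b)) = 0" "bracket (Some (Inr a)) (Some (Inr b)) = 0"
  "bracket (Some (Inl a)) (Some (Inr b)) = (if a = b then -4 else 0)"
  "bracket (Some (Inr a)) (Some (Inl b)) = (if a = b then 4 else 0)"
  by (auto simp: bracket_def split: option.splits sum.splits)

lemma bracket_antisym: "bracket j i = - bracket i j"
  by (auto simp: bracket_def split: option.splits sum.splits)

text \<open>The fields are affine. Moving along one of them changes another one by a multiple of \<open>T\<close>;
  this carries the whole noncommutativity. In particular each field is constant along
  its own integral curves, which are therefore straight lines.\<close>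

lemma lfield_shift:
  "lfield i (p + s *\<^sub>R lfield j p) = lfield i p - (s * bracket i j / 2) *\<^sub>R lfield None p"
  by (cases p) (auto simp: lfield_def bracket_def hframe_def axis_def algebra_simps zero_prod_def split: option.splits sum.splits)

lemma lfield_None: "lfield None p = (0, 0, 1)"
  by (simp add: lfield_def)

lemma lfield_shift_T: "lfield i (p + s *\<^sub>R lfield None q) = lfield i p"
  by (cases p) (auto simp: lfield_def hframe_def split: option.splits sum.splits)

lemma bounded_linear_hcoord: "bounded_linear (hcoord k)"
proof (cases k)
  case (Inl j)
  have "hcoord k = (\<lambda>p. fst p $ j)" by (auto simp: hcoord_def Inl)
  then show ?thesis
    using bounded_linear_compose[OF bounded_linear_vec_nth bounded_linear_fst] by simp
next
  case (Inr j)
  have "hcoord k = (\<lambda>p. fst (snd p) $ j)" by (auto simp: hcoord_def Inr)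
  then show ?thesis
    using bounded_linear_compose[OF bounded_linear_vec_nth
        bounded_linear_compose[OF bounded_linear_fst bounded_linear_snd]] by simp
qed

lemma sum_UNIV_sum: "(\<Sum>k\<in>(UNIV :: ('a::finite + 'b::finite) set). f k) = (\<Sum>j\<in>UNIV. f (Inl j)) + (\<Sum>j\<in>UNIV. f (Inr j))"
  unfolding UNIV_Plus_UNIV[symmetric] by (subst sum.Plus) auto

text \<open>The horizontal fields and \<open>T\<close> form a frame; the coordinate forms and the contact form are the
  dual frame.\<close>

lemma heis_expand:
  "v = (\<Sum>l\<in>UNIV. hcoord l v *\<^sub>R lfield (Some l) p) + contact_form p v *\<^sub>R lfield None p"
proof -
  obtain x y t a b c where pv: "p = (x, y, t)" "v = (a, b, c)" by (cases p, cases v)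
  have e: "(\<Sum>j\<in>UNIV. a $ j *\<^sub>R (axis j 1 :: real^'n)) = a" for a
    by (auto simp: vec_eq_iff axis_def if_distrib cong: if_cong)
  have f: "fst (\<Sum>j\<in>S. h j) = (\<Sum>j\<in>S. fst (h j))" "snd (\<Sum>j\<in>S. h j) = (\<Sum>j\<in>S. snd (h j))"
    for S :: "'n set" and h :: "'n \<Rightarrow> 'd::comm_monoid_add \<times> 'e::comm_monoid_add"
    by (induction S rule: infinite_finite_induct) auto
  show ?thesis
    unfolding pv
    by (auto simp: sum_UNIV_sum hcoord_def lfield_def hframe_def contact_form_def prod_eq_iff f
        scaleR_prod_def e sum_distrib_left sum.distrib[symmetric] sum_negf algebra_simps sum_subtractf)
qed

text \<open>The derivative along a field is taken along its integral line. Frechet differentiability is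
  not built in, since one function will have to be differentiated along the fields before it is
  known to be differentiable.\<close>

definition has_lie :: "('n + 'n) option \<Rightarrow> (('n::finite) heis \<Rightarrow> 'b::real_normed_vector) \<Rightarrow> 'n heis \<Rightarrow> 'b \<Rightarrow> bool" where
  "has_lie i f p D \<longleftrightarrow> ((\<lambda>s. f (p + s *\<^sub>R lfield i p)) has_vector_derivative D) (at 0)"

definition lie :: "('n + 'n) option \<Rightarrow> (('n::finite) heis \<Rightarrow> 'b::real_normed_vector) \<Rightarrow> 'n heis \<Rightarrow> 'b" where
  "lie i f p = vector_derivative (\<lambda>s. f (p + s *\<^sub>R lfield i p)) (at 0)"

abbreviation "lie_differentiable i f p \<equiv> has_lie i f p (lie i f p)"

lemma has_lie_eq: "has_lie i f p D \<Longrightarrow> lie i f p = D"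
  unfolding has_lie_def lie_def by (rule vector_derivative_at)

lemma has_lie_lie: "has_lie i f p D \<Longrightarrow> lie_differentiable i f p"
  using has_lie_eq by metis

lemma has_lie_unique: "has_lie i f p D \<Longrightarrow> has_lie i f p E \<Longrightarrow> D = E"
  using has_lie_eq by metis

lemma has_lie_const: "has_lie i (\<lambda>p. c) p 0"
  by (simp add: has_lie_def)

lemma has_lie_add: "has_lie i f p D \<Longrightarrow> has_lie i g p E \<Longrightarrow> has_lie i (\<lambda>q. f q + g q) p (D + E)"
  unfolding has_lie_def by (rule has_vector_derivative_add)

lemma has_lie_diff: "has_lie i f p D \<Longrightarrow> has_lie i g p E \<Longrightarrow> has_lie i (\<lambda>q. f q - g q) p (D - E)"
  unfolding has_lie_def by (rule has_vector_derivative_diff)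

lemma has_lie_linear: "bounded_linear h \<Longrightarrow> has_lie i f p D \<Longrightarrow> has_lie i (\<lambda>q. h (f q)) p (h D)"
  unfolding has_lie_def by (rule bounded_linear.has_vector_derivative)

lemma has_lie_mult:
  fixes f g :: "('n::finite) heis \<Rightarrow> 'b::real_normed_algebra"
  shows "has_lie i f p D \<Longrightarrow> has_lie i g p E \<Longrightarrow> has_lie i (\<lambda>q. f q * g q) p (f p * E + D * g p)"
  unfolding has_lie_def by (drule (1) has_vector_derivative_mult) simp

lemma has_lie_sum:
  "(\<And>j. j \<in> S \<Longrightarrow> has_lie i (f j) p (D j)) \<Longrightarrow> has_lie i (\<lambda>q. \<Sum>j\<in>S. f j q) p (\<Sum>j\<in>S. D j)"
  unfolding has_lie_def by (rule has_vector_derivative_sum)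

lemma has_lie_power2:
  fixes f :: "('n::finite) heis \<Rightarrow> 'b::{comm_ring_1, real_normed_algebra}"
  shows "has_lie i f p D \<Longrightarrow> has_lie i (\<lambda>q. (f q)\<^sup>2) p (2 * f p * D)"
  using has_lie_mult[of i f p D f D] by (simp add: power2_eq_square algebra_simps)

lemmas has_lie_minus = has_lie_linear[OF bounded_linear_minus[OF bounded_linear_ident]]
  and has_lie_cnj = has_lie_linear[OF bounded_linear_cnj]
  and has_lie_Re = has_lie_linear[OF bounded_linear_Re]
  and has_lie_Im = has_lie_linear[OF bounded_linear_Im]
  and has_lie_of_real = has_lie_linear[OF bounded_linear_of_real]

lemmas has_lie_intros = has_lie_const has_lie_add has_lie_diff has_lie_minus has_lie_mult has_lie_sum
  has_lie_power2 has_lie_cnj has_lie_Re has_lie_Im has_lie_of_real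

lemma open_line:
  assumes "open U" "(p::'a::real_normed_vector) \<in> U"
  obtains e where "e > 0" "\<And>s. \<bar>s\<bar> < e \<Longrightarrow> p + s *\<^sub>R v \<in> U"
proof -
  have "open ((\<lambda>s::real. p + s *\<^sub>R v) -` U)"
    by (intro open_vimage assms continuous_intros)
  then obtain e where "e > 0" "ball 0 e \<subseteq> (\<lambda>s::real. p + s *\<^sub>R v) -` U"
    using assms(2) by (metis (no_types, lifting) add.right_neutral open_contains_ball scaleR_zero_left vimageI)
  then show ?thesis using that by (auto simp: subset_iff)
qed

lemma has_lie_cong:
  assumes "open U" "p \<in> U" "\<And>q. q \<in> U \<Longrightarrow> f q = g q"
  shows "has_lie i f p D = has_lie i g p D"
proof -
  obtain e where e: "e > 0" "\<And>s. \<bar>s\<bar> < e \<Longrightarrow> p + s *\<^sub>R lfield i p \<in> U"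
    using open_line assms by metis
  show ?thesis
    unfolding has_lie_def
  proof (rule has_vector_derivative_cong_ev)
    have "f (p + s *\<^sub>R lfield i p) = g (p + s *\<^sub>R lfield i p)" if "\<bar>s\<bar> < e" for s
      using e(2)[OF that] assms(3) by blast
    then show "\<forall>\<^sub>F s in nhds 0. s \<in> UNIV \<longrightarrow> f (p + s *\<^sub>R lfield i p) = g (p + s *\<^sub>R lfield i p)"
      using e(1) by (auto simp: eventually_nhds_metric dist_norm)
  qed (use assms in auto)
qed

lemma lie_cong:
  assumes "open U" "p \<in> U" "\<And>q. q \<in> U \<Longrightarrow> f q = g q"
  shows "lie i f p = lie i g p"
  using has_lie_cong[OF assms(1,2), of f g] assms(3) unfolding has_lie_def lie_def vector_derivative_def by simp

lemma has_lie_along: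
  assumes "has_lie i f (p + r *\<^sub>R lfield i p) D"
  shows "((\<lambda>s. f (p + s *\<^sub>R lfield i p)) has_vector_derivative D) (at r)"
proof -
  have "bracket i i = 0" using bracket_antisym[of i i] by simp
  then have "((\<lambda>t. f (p + r *\<^sub>R lfield i p + t *\<^sub>R lfield i p)) has_vector_derivative D) (at (r - r))"
    using assms by (simp add: has_lie_def lfield_shift)
  moreover have "((\<lambda>t. t - r) has_vector_derivative 1) (at r)"
    by (auto intro!: derivative_eq_intros)
  ultimately show ?thesis
    using vector_diff_chain_at[where f="\<lambda>t. t - r"] by (fastforce simp: o_def algebra_simps)
qed

lemma has_vector_derivative_curve:
  assumes "f differentiable (at (c s))" "(c has_vector_derivative v) (at s)"
  shows "((\<lambda>s. f (c s)) has_vector_derivative frechet_derivative f (at (c s)) v) (at s)"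
  using vector_derivative_diff_chain_within[OF assms(2), of f "frechet_derivative f (at (c s))"]
    assms(1)[unfolded frechet_derivative_works]
  by (simp add: o_def has_derivative_at_withinI)

lemma differentiable_has_lie:
  assumes "f differentiable (at p)"
  shows "has_lie i f p (frechet_derivative f (at p) (lfield i p))"
  unfolding has_lie_def
  by (rule has_vector_derivative_eq_rhs, rule has_vector_derivative_curve)
    (use assms in \<open>auto intro!: derivative_eq_intros\<close>)

lemma lie_frechet:
  "f differentiable (at p) \<Longrightarrow> lie i f p = frechet_derivative f (at p) (lfield i p)"
  by (rule has_lie_eq[OF differentiable_has_lie])

lemma frechet_lie:
  assumes "f differentiable (at p)"
  shows "frechet_derivative f (at p) v
    = (\<Sum>l\<in>UNIV. hcoord l v *\<^sub>R lie (Some l) f p) + contact_form p v *\<^sub>R lie None f p"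
proof -
  interpret linear "frechet_derivative f (at p)" using linear_frechet_derivative[OF assms] .
  show ?thesis
    by (subst heis_expand[of v p]) (simp add: add sum scale lie_frechet[OF assms])
qed

lemma Ck_on_ident: "Ck_on k U (\<lambda>p. p)"
  by (cases k) auto

lemma Ck_on_contact_form:
  assumes "open U" shows "Ck_on k U (\<lambda>p::'n::finite heis. contact_form p v)"
proof -
  obtain a b c where v: "v = (a, b, c)" by (cases v)
  have "contact_form p v = c + 2 * (\<Sum>j\<in>UNIV. hcoord (Inl j) p * b $ j - hcoord (Inr j) p * a $ j)"
    for p :: "'n heis"
    by (cases p) (simp add: v contact_form_def hcoord_def)
  then show ?thesis
    by (simp add: assms Ck_on_intros Ck_on_linear[OF bounded_linear_hcoord] Ck_on_ident)
qed

text \<open>In the definition of C^k the constant directions may be replaced by the left invariant fields,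
  because the two frames are related by polynomial coefficients.\<close>

lemma Ck_on_Suc_lie:
  assumes "open U"
  shows "Ck_on (Suc k) U f \<longleftrightarrow> (\<forall>p\<in>U. f differentiable (at p)) \<and> (\<forall>i. Ck_on k U (lie i f))"
proof (intro iffI conjI allI)
  assume r: "(\<forall>p\<in>U. f differentiable (at p)) \<and> (\<forall>i. Ck_on k U (lie i f))"
  have "Ck_on k U (\<lambda>p. frechet_derivative f (at p) v)" for v
  proof (rule Ck_on_cong[OF assms])
    show "Ck_on k U (\<lambda>p. (\<Sum>l\<in>UNIV. hcoord l v *\<^sub>R lie (Some l) f p) + contact_form p v *\<^sub>R lie None f p)"
      using r by (intro Ck_on_intros Ck_on_contact_form assms) auto
  next
    fix p assume "p \<in> U"
    then show "(\<Sum>l\<in>UNIV. hcoord l v *\<^sub>R lie (Some l) f p) + contact_form p v *\<^sub>R lie None f p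
        = frechet_derivative f (at p) v"
      using r frechet_lie[of f p v] by simp
  qed
  then show "Ck_on (Suc k) U f" using r by simp
next
  fix i assume l: "Ck_on (Suc k) U f"
  have T: "Ck_on k U (lie None f)"
    by (rule Ck_on_cong[OF assms, of "\<lambda>p. frechet_derivative f (at p) (0, 0, 1)"])
      (use l in \<open>auto simp: lie_frechet lfield_None\<close>)
  show "Ck_on k U (lie i f)"
  proof (cases i)
    case (Some m)
    obtain e c m' where e: "\<And>p. lfield i p = e + (c * hcoord m' p) *\<^sub>R lfield None p"
    proof (cases m)
      case (Inl j)
      have "lfield i p = (axis j 1, 0, 0) + (2 * hcoord (Inr j) p) *\<^sub>R lfield None p" for p
        by (cases p) (simp add: lfield_def hframe_def hcoord_def Some Inl)
      then show ?thesis using that by blast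
    next
      case (Inr j)
      have "lfield i p = (0, axis j 1, 0) + ((-2) * hcoord (Inl j) p) *\<^sub>R lfield None p" for p
        by (cases p) (simp add: lfield_def hframe_def hcoord_def Some Inr)
      then show ?thesis using that by blast
    qed
    have "lie i f p = frechet_derivative f (at p) e + (c * hcoord m' p) *\<^sub>R lie None f p" if "p \<in> U" for p
    proof -
      have d: "f differentiable (at p)" using l that by simp
      then interpret linear "frechet_derivative f (at p)" using linear_frechet_derivative by blast
      show ?thesis by (simp only: lie_frechet[OF d] e add scale)
    qed
    moreover have "Ck_on k U (\<lambda>p. frechet_derivative f (at p) e + (c * hcoord m' p) *\<^sub>R lie None f p)"
      using l[unfolded Ck_on.simps(2)]
      by (intro Ck_on_intros Ck_on_const assms T Ck_on_linear[OF bounded_linear_hcoord] Ck_on_ident)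
        blast
    ultimately show ?thesis using Ck_on_cong[OF assms] by (metis (no_types, lifting))
  qed (use T in simp)
next
  assume "Ck_on (Suc k) U f"
  then show "\<forall>p\<in>U. f differentiable (at p)" unfolding Ck_on.simps by blast
qed

lemma C1_differentiable: "Ck_on (Suc 0) U f \<Longrightarrow> p \<in> U \<Longrightarrow> f differentiable (at p)"
  unfolding Ck_on.simps by blast

lemma C1_lie_differentiable: "Ck_on (Suc 0) U f \<Longrightarrow> p \<in> U \<Longrightarrow> lie_differentiable i f p"
  by (rule has_lie_lie[OF differentiable_has_lie[OF C1_differentiable]])

lemma open_plane:
  assumes "open U" "\<And>x. isCont q (x :: real \<times> real)" "q (0, 0) \<in> U"
  obtains e where "e > 0" "\<And>s r. \<bar>s\<bar> < e \<Longrightarrow> \<bar>r\<bar> < e \<Longrightarrow> q (s, r) \<in> U"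
proof -
  have "open (q -` U)"
    by (intro open_vimage assms continuous_at_imp_continuous_on) (use assms in auto)
  then obtain e where e: "e > 0" "ball (0, 0) e \<subseteq> q -` U"
    using assms(3) by (meson open_contains_ball vimageI2)
  have "q (s, r) \<in> U" if "\<bar>s\<bar> < e/2" "\<bar>r\<bar> < e/2" for s r
  proof -
    have "dist (0, 0) (s, r) \<le> \<bar>s\<bar> + \<bar>r\<bar>"
      using norm_Pair_le[of s r] by (simp add: dist_norm norm_prod_def)
    also have "\<dots> < e" using that by simp
    finally show ?thesis using e(2) by (auto simp: subset_iff)
  qed
  then show ?thesis using that[of "e/2"] e(1) by simp
qed

text \<open>A product with a factor vanishing at the point can be differentiated there even if the other
  factor is merely continuous.\<close>

lemma has_vector_derivative_scaleR_isCont: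
  fixes k :: "real \<Rightarrow> 'b::real_normed_vector"
  assumes "isCont k 0"
  shows "((\<lambda>s. s *\<^sub>R k s) has_vector_derivative k 0) (at 0)"
  unfolding has_vector_derivative_def has_derivative_at_alt
proof (intro conjI allI impI)
  fix e :: real assume "e > 0"
  then obtain d where d: "d > 0" "\<And>s. dist s 0 < d \<Longrightarrow> dist (k s) (k 0) < e"
    using assms unfolding continuous_at_eps_delta by blast
  have "norm (s *\<^sub>R k s - s *\<^sub>R k 0) \<le> e * norm s" if "norm s < d" for s
  proof -
    have "norm (s *\<^sub>R k s - s *\<^sub>R k 0) = \<bar>s\<bar> * norm (k s - k 0)"
      by (simp flip: scaleR_diff_right)
    also have "\<dots> \<le> \<bar>s\<bar> * e"
      using d(2)[of s] that by (intro mult_left_mono) (auto simp: dist_norm)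
    finally show ?thesis by (simp add: mult.commute)
  qed
  then show "\<exists>d>0. \<forall>y. norm (y - 0) < d \<longrightarrow>
      norm (y *\<^sub>R k y - 0 *\<^sub>R k 0 - (y - 0) *\<^sub>R k 0) \<le> e * norm (y - 0)"
    using d(1) by auto
qed (simp add: bounded_linear_scaleR_left)

text \<open>The commutator formula for a function that is not C^2. In the case of commuting constant fields it
  is the theorem of Schwarz on the parallelogram spanned by \<open>V\<close> and \<open>W\<close>. Here the
  parallelogram is twisted: the surface \<open>q\<close> is formed by the integral lines of \<open>V\<close> that start
  on the integral line of \<open>W\<close> through \<open>p\<close>. Its other tangent vector, at the points where
  \<open>r = 0\<close>, differs from \<open>W\<close> by \<open>2 s d T\<close>, and this term produces the bracket.\<close>

lemma lie_commutator:
  assumes U: "open U" "p \<in> U" and f: "Ck_on (Suc 0) U f" and g: "Ck_on (Suc 0) U (lie i f)"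
  shows "has_lie i (lie j f) p (lie j (lie i f) p + bracket i j *\<^sub>R lie None f p)"
proof -
  define V W T d where "V = lfield i p" and "W = lfield j p" and "T = lfield None p" and "d = - bracket i j / 2"
  define q where "q s r = p + r *\<^sub>R W + s *\<^sub>R V + (s * r * d) *\<^sub>R T" for s r
  define g' where "g' = lie i f"
  have ii: "bracket i i = 0" using bracket_antisym[of i i] by simp
  have T: "lfield None x = T" for x by (simp add: T_def lfield_None)
  have fi: "lfield i (q s r) = V + (r * d) *\<^sub>R T" for s r
  proof -
    have 1: "lfield i (p + r *\<^sub>R W) = V + (r * d) *\<^sub>R T"
      by (simp add: W_def lfield_shift V_def T d_def)
    have 2: "q s r = (p + r *\<^sub>R W) + s *\<^sub>R lfield i (p + r *\<^sub>R W)"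
      unfolding 1 by (simp add: q_def algebra_simps)
    show ?thesis unfolding 2 lfield_shift ii using 1 by simp
  qed
  have fj: "lfield j (p + s *\<^sub>R V) = W - (s * d) *\<^sub>R T" for s
    by (simp add: V_def lfield_shift W_def T d_def bracket_antisym[of j i])
  have qc: "isCont (\<lambda>x. q (fst x) (snd x)) x" for x
    unfolding q_def by (intro continuous_intros)
  obtain e where e: "e > 0" "\<And>s r. \<bar>s\<bar> < e \<Longrightarrow> \<bar>r\<bar> < e \<Longrightarrow> q s r \<in> U"
    using open_plane[OF U(1) qc] U(2) by (auto simp: q_def)
  have linf: "linear (frechet_derivative f (at x))" and ling: "linear (frechet_derivative g' (at x))"
    if "x \<in> U" for x
    unfolding g'_def
    by (rule linear_frechet_derivative[OF C1_differentiable], rule f g, rule that)+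
  define \<Phi>12 where "\<Phi>12 s r = frechet_derivative g' (at (q s r)) W
    + (s * d) *\<^sub>R frechet_derivative g' (at (q s r)) T" for s r
  define \<Phi>2 where "\<Phi>2 s = frechet_derivative f (at (q s 0)) (W + (s * d) *\<^sub>R T)" for s
  have "(\<Phi>2 has_vector_derivative \<Phi>12 0 0) (at 0)"
  proof (rule mixed_derivative_commute[OF e(1), where \<Phi> = "\<lambda>s r. f (q s r)"
        and ?\<Phi>1.0 = "\<lambda>s r. g' (q s r)" and ?\<Phi>12.0 = \<Phi>12])
    fix s r assume sr: "\<bar>s\<bar> < e" "\<bar>r\<bar> < e"
    have fd: "f differentiable (at (q s r))" and gd: "g' differentiable (at (q s r))"
      using C1_differentiable[OF f e(2)[OF sr]] C1_differentiable[OF g e(2)[OF sr]]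
      by (auto simp: g'_def)
    have "((\<lambda>s. q s r) has_vector_derivative lfield i (q s r)) (at s)"
      unfolding fi unfolding q_def by (auto intro!: derivative_eq_intros)
    from has_vector_derivative_curve[OF fd this]
    show "((\<lambda>s. f (q s r)) has_vector_derivative g' (q s r)) (at s)"
      by (simp add: g'_def lie_frechet[OF fd])
    have "((\<lambda>r. q s r) has_vector_derivative W + (s * d) *\<^sub>R T) (at r)"
      unfolding q_def by (auto intro!: derivative_eq_intros)
    from has_vector_derivative_curve[OF gd this]
    show "((\<lambda>r. g' (q s r)) has_vector_derivative \<Phi>12 s r) (at r)"
      by (simp add: \<Phi>12_def linear_add[OF ling] linear_scale[OF ling] e(2)[OF sr])
  next
    fix s :: real assume s: "\<bar>s\<bar> < e"
    have "((\<lambda>r. q s r) has_vector_derivative W + (s * d) *\<^sub>R T) (at 0)"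
      unfolding q_def by (auto intro!: derivative_eq_intros)
    from has_vector_derivative_curve[OF C1_differentiable[OF f e(2)[OF s, of 0]] this]
    show "((\<lambda>r. f (q s r)) has_vector_derivative \<Phi>2 s) (at 0)"
      using e(1) by (simp add: \<Phi>2_def)
  next
    have c: "isCont (\<lambda>x. frechet_derivative g' (at (q (fst x) (snd x))) v) (0, 0)" for v
    proof (rule isCont_o2[OF qc])
      have "continuous_on U (\<lambda>x. frechet_derivative g' (at x) v)"
        using g unfolding g'_def Ck_on.simps by blast
      then show "isCont (\<lambda>x. frechet_derivative g' (at x) v) (q (fst (0, 0)) (snd (0, 0)))"
        using U by (simp add: continuous_on_eq_continuous_at q_def)
    qed
    show "isCont (\<lambda>x. \<Phi>12 (fst x) (snd x)) (0, 0)"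
      unfolding \<Phi>12_def by (intro continuous_intros c)
  qed
  then have 1: "(\<Phi>2 has_vector_derivative lie j g' p) (at 0)"
    using lie_frechet[OF C1_differentiable[OF g U(2)], of j] by (simp add: \<Phi>12_def q_def W_def g'_def)
  have 2: "((\<lambda>s. s *\<^sub>R lie None f (q s 0)) has_vector_derivative lie None f (q 0 0)) (at 0)"
  proof (rule has_vector_derivative_scaleR_isCont, rule isCont_o2[of 0 "\<lambda>s. q s 0"])
    show "isCont (\<lambda>s. q s 0) 0" unfolding q_def by (intro continuous_intros)
    have "continuous_on U (lie None f)"
      using f Ck_on_Suc_lie[OF U(1), of 0 f] by simp
    then show "isCont (lie None f) (q 0 0)"
      using U by (simp add: continuous_on_eq_continuous_at q_def)
  qed
  \<comment> \<open>\<open>\<Phi>2\<close> is the derivative of \<open>f\<close> along the surface; subtracting the \<open>T\<close> part of the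
    tangent vector leaves the derivative along \<open>W\<close>\<close>
  have "((\<lambda>s. \<Phi>2 s - (2 * d) *\<^sub>R (s *\<^sub>R lie None f (q s 0))) has_vector_derivative
      lie j g' p + bracket i j *\<^sub>R lie None f p) (at 0)"
    using has_vector_derivative_diff[OF 1 bounded_linear.has_vector_derivative[OF
          bounded_linear_scaleR_right 2, of "2 * d"]]
    by (simp add: d_def q_def)
  then show ?thesis
    unfolding has_lie_def g'_def
  proof (rule has_vector_derivative_transform_within_open[of _ _ _ "{-e<..<e}"])
    fix s assume "s \<in> {-e<..<e}"
    then have s: "q s 0 \<in> U" using e(2)[of s 0] e(1) by auto
    have q0: "q s 0 = p + s *\<^sub>R V" by (simp add: q_def)
    show "\<Phi>2 s - (2 * d) *\<^sub>R (s *\<^sub>R lie None f (q s 0)) = lie j f (p + s *\<^sub>R lfield i p)"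
      unfolding V_def[symmetric] using s
      by (simp add: \<Phi>2_def q0 lie_frechet[OF C1_differentiable[OF f]] fj T linear_add[OF linf]
          linear_scale[OF linf] linear_diff[OF linf] algebra_simps flip: scaleR_left_distrib)
  qed (use e in auto)
qed

text \<open>Since \<open>T\<close> commutes with every field, the surface spanned by \<open>T\<close> and the field \<open>i\<close> is
  flat, and Peano's form of the theorem of Schwarz applies directly: in contrast to
  \<open>lie_commutator\<close>, the function \<open>T f\<close> need not be C^1.\<close>

lemma lie_commute_T:
  assumes U: "open U" "p \<in> U" and f: "Ck_on (Suc 0) U f"
    and h: "\<And>x. x \<in> U \<Longrightarrow> has_lie i (lie None f) x (h x)" and c: "continuous_on U h"
  shows "has_lie None (lie i f) p (h p)"
proof -
  define V T where "V = lfield i p" and "T = lfield None p"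
  define q where "q s r = p + r *\<^sub>R V + s *\<^sub>R T" for s r :: real
  have q': "q s r = q s 0 + r *\<^sub>R V" for s r by (simp add: q_def algebra_simps)
  have T: "lfield None x = T" for x by (simp add: T_def lfield_None)
  have ii: "bracket i i = 0" using bracket_antisym[of i i] by simp
  have fi: "lfield i (q s r) = V" for s r
  proof -
    have "lfield i (q s r) = lfield i (p + r *\<^sub>R V)"
      unfolding q_def T_def by (rule lfield_shift_T)
    then show ?thesis by (simp add: V_def lfield_shift ii)
  qed
  have qc: "isCont (\<lambda>x. q (fst x) (snd x)) x" for x
    unfolding q_def by (intro continuous_intros)
  obtain e where e: "e > 0" "\<And>s r. \<bar>s\<bar> < e \<Longrightarrow> \<bar>r\<bar> < e \<Longrightarrow> q s r \<in> U"
    using open_plane[OF U(1) qc] U(2) by (auto simp: q_def)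
  have "((\<lambda>s. lie i f (q s 0)) has_vector_derivative h (q 0 0)) (at 0)"
  proof (rule mixed_derivative_commute[OF e(1), where \<Phi> = "\<lambda>s r. f (q s r)"
        and ?\<Phi>1.0 = "\<lambda>s r. lie None f (q s r)" and ?\<Phi>12.0 = "\<lambda>s r. h (q s r)"])
    fix s r assume sr: "\<bar>s\<bar> < e" "\<bar>r\<bar> < e"
    have fd: "f differentiable (at (q s r))" using C1_differentiable[OF f e(2)[OF sr]] .
    have "((\<lambda>s. q s r) has_vector_derivative lfield None (q s r)) (at s)"
      unfolding T unfolding q_def by (auto intro!: derivative_eq_intros)
    from has_vector_derivative_curve[OF fd this]
    show "((\<lambda>s. f (q s r)) has_vector_derivative lie None f (q s r)) (at s)"
      by (simp add: lie_frechet[OF fd])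
    show "((\<lambda>r. lie None f (q s r)) has_vector_derivative h (q s r)) (at r)"
      using has_lie_along[of i "lie None f" "q s 0" r "h (q s r)"] h[OF e(2)[OF sr]]
      by (simp add: fi q'[symmetric])
  next
    fix s :: real assume s: "\<bar>s\<bar> < e"
    show "((\<lambda>r. f (q s r)) has_vector_derivative lie i f (q s 0)) (at 0)"
      using C1_lie_differentiable[OF f e(2)[OF s, of 0], of i] e(1) by (simp add: has_lie_def fi q'[symmetric])
  next
    show "isCont (\<lambda>x. h (q (fst x) (snd x))) (0, 0)"
      by (rule isCont_o2[OF qc]) (use c U in \<open>simp add: continuous_on_eq_continuous_at q_def\<close>)
  qed
  then show ?thesis by (simp add: has_lie_def q_def T_def)
qed

text \<open>The coordinate directions have the form \<open>V + a T\<close> with a field \<open>V\<close> and a scalar \<open>a\<close>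
  depending on the point. As \<open>V\<close> and \<open>T\<close> commute, \<open>f\<close> restricted to a plane spanned by them
  has continuous partial derivatives, so it can be differentiated along \<open>V + a T\<close>. Thus \<open>f\<close> has
  continuous partial derivatives in the usual sense.\<close>

lemma C1_from_lie:
  fixes f :: "('n::finite) heis \<Rightarrow> 'b::real_normed_vector"
  assumes U: "open U"
    and h: "\<And>i x. x \<in> U \<Longrightarrow> has_lie i f x (h i x)" and c: "\<And>i. continuous_on U (h i)"
  shows "Ck_on (Suc 0) U f"
proof -
  have slanted: "((\<lambda>s. f (x + s *\<^sub>R (lfield i x + a *\<^sub>R lfield None x))) has_vector_derivative
      h i x + a *\<^sub>R h None x) (at 0)" if x: "x \<in> U" for i x a
  proof -
    define V T where "V = lfield i x" and "T = lfield None x"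
    define q where "q z = x + fst z *\<^sub>R V + snd z *\<^sub>R T" for z :: "real \<times> real"
    have T: "lfield None y = T" for y by (simp add: T_def lfield_None)
    have ii: "bracket i i = 0" using bracket_antisym[of i i] by simp
    have fi: "lfield i (q z) = V" for z
      unfolding q_def T_def by (simp add: V_def lfield_shift_T lfield_shift ii)
    have qc: "isCont q z" for z unfolding q_def by (intro continuous_intros)
    have Uq: "open (q -` U)" by (intro open_vimage U continuous_at_imp_continuous_on) (use qc in auto)
    have "((\<lambda>z. f (q z)) has_derivative
        (\<lambda>v. \<Sum>b\<in>Basis. (v \<bullet> b) *\<^sub>R (if b = (1, 0) then h i (q 0) else h None (q 0)))) (at 0)"
    proof (rule has_derivative_from_partials[OF Uq, where
          G = "\<lambda>b z. if b = (1, 0) then h i (q z) else h None (q z)"])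
      show "0 \<in> q -` U" using x by (simp add: q_def)
      fix y b :: "real \<times> real" assume y: "y \<in> q -` U" and b: "b \<in> Basis"
      have qy: "q (y + s *\<^sub>R b) = q y + s *\<^sub>R (if b = (1, 0) then lfield i (q y) else lfield None (q y))" for s
        using b unfolding fi T by (auto simp: q_def Basis_prod_def algebra_simps)
      show "((\<lambda>s. f (q (y + s *\<^sub>R b))) has_vector_derivative
          (if b = (1, 0) then h i (q y) else h None (q y))) (at 0)"
        using h[of "q y"] y unfolding has_lie_def qy by auto
    next
      have "continuous_on (q -` U) (\<lambda>z. h j (q z))" for j
        by (rule continuous_on_compose2[OF c[of j] continuous_at_imp_continuous_on]) (use qc in auto)
      then show "continuous_on (q -` U) (\<lambda>z. if b = (1, 0) then h i (q z) else h None (q z))" for b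
        by (cases "b = (1, 0)") auto
    qed
    then have D: "((\<lambda>z. f (q z)) has_derivative
        (\<lambda>v. \<Sum>b\<in>Basis. (v \<bullet> b) *\<^sub>R (if b = (1, 0) then h i (q 0) else h None (q 0))))
        (at (0, 0 * a) within range (\<lambda>s. (s, s * a)))"
      by (simp add: zero_prod_def has_derivative_at_withinI)
    have "((\<lambda>s. (s, s * a)) has_vector_derivative (1, a)) (at 0)"
      by (auto intro!: derivative_eq_intros has_vector_derivative_Pair)
    from vector_derivative_diff_chain_within[OF this D]
    have "((\<lambda>s. f (q (s, s * a))) has_vector_derivative
        (\<Sum>b\<in>Basis. ((1::real, a) \<bullet> b) *\<^sub>R (if b = (1, 0) then h i (q 0) else h None (q 0)))) (at 0)"
      by (simp add: o_def)
    moreover have "(\<Sum>b\<in>Basis. ((1::real, a) \<bullet> b) *\<^sub>R (if b = (1::real, 0::real) then h i (q 0) else h None (q 0)))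
        = h i x + a *\<^sub>R h None x"
      by (simp add: Basis_prod_def sum.union_disjoint q_def)
    ultimately show ?thesis
      by (simp add: q_def V_def T_def algebra_simps)
  qed
  have "f differentiable (at x)" if x: "x \<in> U" for x
  proof -
    have "\<exists>i A. continuous_on U A \<and> (\<forall>y. b = lfield i y + A y *\<^sub>R lfield None y)" if b: "b \<in> Basis" for b :: "'n heis"
    proof -
      consider j where "b = (axis j 1, 0, 0)" | j where "b = (0, axis j 1, 0)" | "b = (0, 0, 1)"
        using b by (auto simp: Basis_prod_def Basis_vec_def zero_prod_def)
      then show ?thesis
      proof cases
        case (1 j)
        have "b = lfield (Some (Inl j)) y + (-2 * hcoord (Inr j) y) *\<^sub>R lfield None y" for y
          by (cases y) (simp add: 1 lfield_def hframe_def hcoord_def)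
        moreover have "continuous_on U (\<lambda>y. -2 * hcoord (Inr j) y :: real)"
          by (intro continuous_intros linear_continuous_on bounded_linear_hcoord)
        ultimately show ?thesis by blast
      next
        case (2 j)
        have "b = lfield (Some (Inr j)) y + (2 * hcoord (Inl j) y) *\<^sub>R lfield None y" for y
          by (cases y) (simp add: 2 lfield_def hframe_def hcoord_def)
        moreover have "continuous_on U (\<lambda>y. 2 * hcoord (Inl j) y :: real)"
          by (intro continuous_intros linear_continuous_on bounded_linear_hcoord)
        ultimately show ?thesis by blast
      next
        case 3
        have "b = lfield None y + 0 *\<^sub>R lfield None y" for y by (simp add: 3 lfield_None)
        then show ?thesis by (intro exI[of _ None] exI[of _ "\<lambda>y. 0"]) auto
      qed
    qed
    then obtain I A where A: "\<And>b. b \<in> Basis \<Longrightarrow> continuous_on U (A b)"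
      "\<And>b y. b \<in> Basis \<Longrightarrow> lfield (I b) y + A b y *\<^sub>R lfield None y = b"
      by (metis (no_types, lifting))
    have "(f has_derivative (\<lambda>v. \<Sum>b\<in>Basis. (v \<bullet> b) *\<^sub>R (h (I b) x + A b x *\<^sub>R h None x))) (at x)"
    proof (rule has_derivative_from_partials[OF U x, where G = "\<lambda>b x. h (I b) x + A b x *\<^sub>R h None x"])
      fix y b :: "'n heis" assume yb: "y \<in> U" "b \<in> Basis"
      show "((\<lambda>s. f (y + s *\<^sub>R b)) has_vector_derivative h (I b) y + A b y *\<^sub>R h None y) (at 0)"
        using slanted[OF yb(1), of "I b" "A b y"] A(2)[OF yb(2), of y] by simp
    qed (auto intro!: continuous_intros c A)
    then show ?thesis by (auto simp: differentiable_def)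
  qed
  moreover have "continuous_on U (lie i f)" for i
    using c[of i] has_lie_eq[OF h] continuous_on_cong[of U U "lie i f" "h i"] by auto
  ultimately show ?thesis using Ck_on_Suc_lie[OF U, of 0 f] by simp
qed

\<comment> \<open>C^1 is used as a hypothesis as it stands, not through its definition\<close>
declare Ck_on.simps(2) [simp del]

section \<open>Complex horizontal fields and unitary frames\<close>

lemma lie_const [simp]: "lie i (\<lambda>p. c) p = 0"
  by (rule has_lie_eq[OF has_lie_const])

abbreviation X :: "'n \<Rightarrow> ('n + 'n) option" where "X k \<equiv> Some (Inl k)"
abbreviation Y :: "'n \<Rightarrow> ('n + 'n) option" where "Y k \<equiv> Some (Inr k)"

text \<open>The holomorphic field \<open>Zd k\<close> and its conjugate \<open>Zb k\<close>; CR functions are those killed by all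
  \<open>Zb k\<close>. The only nonzero commutators are \<open>[Zd k, Zb k] = -2 i T\<close>.\<close>

definition Zd :: "'n \<Rightarrow> (('n::finite) heis \<Rightarrow> complex) \<Rightarrow> 'n heis \<Rightarrow> complex" where
  "Zd k f p = (lie (X k) f p - \<i> * lie (Y k) f p) / 2"

definition Zb :: "'n \<Rightarrow> (('n::finite) heis \<Rightarrow> complex) \<Rightarrow> 'n heis \<Rightarrow> complex" where
  "Zb k f p = (lie (X k) f p + \<i> * lie (Y k) f p) / 2"

lemma lie_X_Z: "lie (X k) f p = Zd k f p + Zb k f p"
  and lie_Y_Z: "lie (Y k) f p = \<i> * (Zd k f p - Zb k f p)"
  by (simp_all add: Zd_def Zb_def field_simps)

text \<open>A square matrix whose columns are orthogonal with squared length \<open>r\<close> also has such rows. This and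
  the next two lemmas solve the linear systems that arise by differentiating relations between
  the columns.\<close>

lemma conformal_frame_inverse:
  fixes B :: "'n::finite \<Rightarrow> 'n \<Rightarrow> complex"
  assumes B: "\<And>k l. (\<Sum>j\<in>UNIV. cnj (B j k) * B j l) = (if k = l then r else 0)" and "r \<noteq> 0"
  shows "(\<Sum>k\<in>UNIV. B i k * cnj (B j k)) = (if i = j then r else 0)"
proof -
  define M :: "complex^'n^'n" where "M = (\<chi> i j. B i j)"
  define M' :: "complex^'n^'n" where "M' = (\<chi> k j. cnj (B j k) / r)"
  have "M' ** M = mat 1"
    using assms by (simp add: matrix_matrix_mult_def M_def M'_def vec_eq_iff mat_def
        sum_divide_distrib[symmetric])
  then have "M ** M' = mat 1" by (simp add: matrix_left_right_inverse)
  then have "(M ** M') $ i $ j = (if i = j then 1 else 0)" by (simp add: mat_def)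
  then have "(\<Sum>k\<in>UNIV. B i k * cnj (B j k)) / r = (if i = j then 1 else 0)"
    by (simp add: matrix_matrix_mult_def M_def M'_def sum_divide_distrib)
  then show ?thesis using assms(2) by (auto simp: divide_eq_eq split: if_splits)
qed

lemma conformal_frame_expand:
  fixes B :: "'n::finite \<Rightarrow> 'n \<Rightarrow> complex"
  assumes B: "\<And>k l. (\<Sum>j\<in>UNIV. cnj (B j k) * B j l) = (if k = l then r else 0)" and "r \<noteq> 0"
    and y: "\<And>k. (\<Sum>j\<in>UNIV. cnj (B j k) * y j) = r * z k"
  shows "y i = (\<Sum>k\<in>UNIV. B i k * z k)"
proof -
  have "r * (\<Sum>k\<in>UNIV. B i k * z k) = (\<Sum>k\<in>UNIV. B i k * (\<Sum>j\<in>UNIV. cnj (B j k) * y j))"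
    by (simp add: y sum_distrib_left mult.left_commute)
  also have "\<dots> = (\<Sum>j\<in>UNIV. \<Sum>k\<in>UNIV. B i k * cnj (B j k) * y j)"
    by (subst sum.swap) (simp add: sum_distrib_left mult.assoc)
  also have "\<dots> = (\<Sum>j\<in>UNIV. (if i = j then r else 0) * y j)"
    by (simp add: conformal_frame_inverse[OF assms(1,2)] flip: sum_distrib_right)
  also have "\<dots> = r * y i" by (simp add: if_distrib[of "\<lambda>x. x * _"] cong: if_cong)
  finally show ?thesis using assms(2) by simp
qed

lemma conformal_frame_inj:
  fixes B :: "'n::finite \<Rightarrow> 'n \<Rightarrow> complex"
  assumes B: "\<And>k l. (\<Sum>j\<in>UNIV. cnj (B j k) * B j l) = (if k = l then r else 0)" and "r \<noteq> 0"
    and z: "\<And>j. (\<Sum>k\<in>UNIV. B j k * z k) = 0"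
  shows "z l = 0"
proof -
  have "0 = (\<Sum>j\<in>UNIV. cnj (B j l) * (\<Sum>k\<in>UNIV. B j k * z k))" by (simp add: z)
  also have "\<dots> = (\<Sum>k\<in>UNIV. \<Sum>j\<in>UNIV. cnj (B j l) * B j k * z k)"
    by (subst sum.swap) (simp add: sum_distrib_left mult.assoc)
  also have "\<dots> = (\<Sum>k\<in>UNIV. (if l = k then r else 0) * z k)"
    by (simp add: B flip: sum_distrib_right)
  also have "\<dots> = r * z l" by (simp add: if_distrib[of "\<lambda>x. x * _"] cong: if_cong)
  finally show ?thesis using assms(2) by simp
qed

section \<open>Rules for functions on an open set\<close>

locale heis_region =
  fixes U :: "('n::finite) heis set"
  assumes open_U: "open U"
begin

abbreviation "C1 f \<equiv> Ck_on (Suc 0) U f"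

lemmas Ck_intros = Ck_on_intros[OF open_U] Ck_on_const

lemma lie_differentiableI: "C1 f \<Longrightarrow> p \<in> U \<Longrightarrow> lie_differentiable i f p" by (rule C1_lie_differentiable)

lemma
  assumes p: "p \<in> U" and f: "C1 f"
  shows lie_cnj: "lie i (\<lambda>q. cnj (f q)) p = cnj (lie i f p)"
    and lie_Re: "lie i (\<lambda>q. Re (f q)) p = Re (lie i f p)"
    and lie_Im: "lie i (\<lambda>q. Im (f q)) p = Im (lie i f p)"
  using has_lie_eq[OF has_lie_cnj[OF lie_differentiableI[OF f p]]] has_lie_eq[OF has_lie_Re[OF lie_differentiableI[OF f p]]]
    has_lie_eq[OF has_lie_Im[OF lie_differentiableI[OF f p]]]
  by auto

lemma
  fixes f g :: "'n heis \<Rightarrow> 'b::real_normed_algebra"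
  assumes "p \<in> U" "C1 f" "C1 g"
  shows lie_mult: "lie i (\<lambda>q. f q * g q) p = f p * lie i g p + lie i f p * g p"
    and lie_add: "lie i (\<lambda>q. f q + g q) p = lie i f p + lie i g p"
    and lie_diff: "lie i (\<lambda>q. f q - g q) p = lie i f p - lie i g p"
  using assms by (blast intro: has_lie_eq has_lie_mult has_lie_add has_lie_diff lie_differentiableI)+

lemma lie_cmult:
  fixes f :: "'n heis \<Rightarrow> 'b::real_normed_algebra"
  shows "p \<in> U \<Longrightarrow> C1 f \<Longrightarrow> lie i (\<lambda>q. c * f q) p = c * lie i f p"
  using lie_mult[OF _ Ck_on_const, of p f i c] by simp

lemma lie_of_real: "p \<in> U \<Longrightarrow> C1 f \<Longrightarrow> lie i (\<lambda>q. of_real (f q)) p = of_real (lie i f p)"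
  by (rule has_lie_eq[OF has_lie_of_real[OF lie_differentiableI]])

lemma lie_sum:
  "p \<in> U \<Longrightarrow> (\<And>j. j \<in> S \<Longrightarrow> C1 (f j)) \<Longrightarrow> lie i (\<lambda>q. \<Sum>j\<in>S. f j q) p = (\<Sum>j\<in>S. lie i (f j) p)"
  by (rule has_lie_eq[OF has_lie_sum]) (auto intro: lie_differentiableI)

lemma C1_lie_cont: "C1 f \<Longrightarrow> continuous_on U (lie i f)"
  unfolding Ck_on_Suc_lie[OF open_U] by simp

lemma commutator:
  assumes "C1 f" "C1 (lie i f)" "p \<in> U"
  shows "lie i (lie j f) p = lie j (lie i f) p + bracket i j *\<^sub>R lie None f p"
  using has_lie_eq[OF lie_commutator[OF open_U assms(3,1,2)]] .

lemma Z_mult: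
  assumes "C1 f" "C1 g" "p \<in> U"
  shows "Zd k (\<lambda>q. f q * g q) p = f p * Zd k g p + Zd k f p * g p"
    and "Zb k (\<lambda>q. f q * g q) p = f p * Zb k g p + Zb k f p * g p"
  using assms by (simp_all add: Zd_def Zb_def lie_mult field_simps)

lemma Z_const: "Zd k (\<lambda>q. c) p = 0" "Zb k (\<lambda>q. c) p = 0"
  by (simp_all add: Zd_def Zb_def)

lemma Z_cmult:
  assumes "C1 f" "p \<in> U"
  shows "Zd k (\<lambda>q. c * f q) p = c * Zd k f p" and "Zb k (\<lambda>q. c * f q) p = c * Zb k f p"
  using assms by (simp_all add: Z_mult Z_const)

lemma Z_cnj:
  assumes "C1 f" "p \<in> U"
  shows "Zd k (\<lambda>q. cnj (f q)) p = cnj (Zb k f p)" and "Zb k (\<lambda>q. cnj (f q)) p = cnj (Zd k f p)"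
  using assms by (simp_all add: Zd_def Zb_def lie_cnj)

lemma Z_sum:
  assumes "\<And>j. j \<in> S \<Longrightarrow> C1 (f j)" "p \<in> U"
  shows "Zd k (\<lambda>q. \<Sum>j\<in>S. f j q) p = (\<Sum>j\<in>S. Zd k (f j) p)"
    and "Zb k (\<lambda>q. \<Sum>j\<in>S. f j q) p = (\<Sum>j\<in>S. Zb k (f j) p)"
  using assms by (simp_all add: Zd_def Zb_def lie_sum sum_distrib_left[symmetric] sum_subtractf
      sum.distrib sum_divide_distrib[symmetric])

lemma Z_cong:
  assumes "p \<in> U" "\<And>q. q \<in> U \<Longrightarrow> f q = g q"
  shows "Zd k f p = Zd k g p" and "Zb k f p = Zb k g p"
  by (simp_all add: Zd_def Zb_def lie_cong[OF open_U assms])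

lemma Z_commutator:
  assumes "C1 f" "C1 (lie (X k) f)" "C1 (lie (Y k) f)" "p \<in> U"
  shows "Zd k (Zb k f) p - Zb k (Zd k f) p = -2 * \<i> * lie None f p"
proof -
  have z: "Zb k f = (\<lambda>q. (1/2) * (lie (X k) f q + \<i> * lie (Y k) f q))"
    "Zd k f = (\<lambda>q. (1/2) * (lie (X k) f q - \<i> * lie (Y k) f q))"
    by (auto simp: Zb_def Zd_def)
  have c: "has_lie i (\<lambda>q. (1/2) * (lie (X k) f q + s * lie (Y k) f q)) p
      ((1/2) * (lie i (lie (X k) f) p + s * lie i (lie (Y k) f) p))" for s :: complex and i
    using has_lie_mult[OF has_lie_const[where c = "1/2"] has_lie_add[OF lie_differentiableI[OF assms(2,4)]
      has_lie_mult[OF has_lie_const[where c = s] lie_differentiableI[OF assms(3,4)]]]] by simp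
  have e: "lie i (Zb k f) p = (1/2) * (lie i (lie (X k) f) p + \<i> * lie i (lie (Y k) f) p)"
    "lie i (Zd k f) p = (1/2) * (lie i (lie (X k) f) p + (-\<i>) * lie i (lie (Y k) f) p)" for i
    unfolding z using has_lie_eq[OF c[of i \<i>]] has_lie_eq[OF c[of i "-\<i>"]] by simp_all
  show ?thesis
    unfolding Zd_def[of k "Zb k f"] Zb_def[of k "Zd k f"] e
      commutator[OF assms(1,2,4), of "Y k"]
    by (simp add: field_simps scaleR_conv_of_real)
qed

lemma C1_cong: "C1 f \<Longrightarrow> (\<And>q. q \<in> U \<Longrightarrow> f q = g q) \<Longrightarrow> C1 g"
  using Ck_on_cong[OF open_U] by blast

lemma Ck_SucI:
  assumes "C1 f" "\<And>k. Ck_on m U (lie (X k) f)" "\<And>k. Ck_on m U (lie (Y k) f)" "Ck_on m U (lie None f)"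
  shows "Ck_on (Suc m) U f"
proof -
  have "Ck_on m U (lie i f)" for i
  proof (cases i)
    case (Some l)
    then show ?thesis using assms by (cases l) auto
  qed (use assms in simp)
  then show ?thesis unfolding Ck_on_Suc_lie[OF open_U] using C1_differentiable[OF assms(1)] by blast
qed

end

section \<open>Contact CR maps and their structure equations\<close>

text \<open>The equations satisfied by the horizontal part \<open>w\<close> of a conformal map and by the factor \<open>lam\<close>
  of the contact form. The hypothesis \<open>lie_lam\<close> is what contactness says about \<open>T\<close> paired with
  a horizontal field.\<close>

locale cr_contact = heis_region U for U :: "('n::finite) heis set" +
  fixes w :: "'n \<Rightarrow> 'n heis \<Rightarrow> complex" and lam :: "'n heis \<Rightarrow> real"
  assumes w_C2: "Ck_on (Suc (Suc 0)) U (w j)"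
    and lam_C1: "Ck_on (Suc 0) U lam"
    and lam_pos: "p \<in> U \<Longrightarrow> lam p > 0"
    and w_CR: "p \<in> U \<Longrightarrow> lie (Y k) (w j) p = \<i> * lie (X k) (w j) p"
    and herm: "p \<in> U \<Longrightarrow> (\<Sum>j\<in>UNIV. cnj (lie (X k) (w j) p) * lie (X l) (w j) p)
        = (if k = l then of_real (lam p) else 0)"
    and lie_lam: "p \<in> U \<Longrightarrow> lie (Some i) lam p
        = 4 * (\<Sum>j\<in>UNIV. Im (cnj (lie (Some i) (w j) p) * lie None (w j) p))"
begin

definition "b j k = lie (X k) (w j)"
definition "Tw j = lie None (w j)"
text \<open>This is \<open>(i/2) Zb k (ln lam)\<close>, written in such a way that it is visibly C^1.\<close>

definition "\<gamma> k p = (\<Sum>j\<in>UNIV. cnj (b j k p) * Tw j p) * inverse (of_real (lam p))"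

lemma w_C1: "C1 (w j)" using Ck_on_SucD[OF w_C2] .
lemma lie_w_C1: "C1 (lie i (w j))" using w_C2[of j] Ck_on_Suc_lie[OF open_U] by blast
lemma b_C1: "C1 (b j k)" unfolding b_def by (rule lie_w_C1)
lemma Tw_C1: "C1 (Tw j)" unfolding Tw_def by (rule lie_w_C1)
lemma \<gamma>_C1: "C1 (\<gamma> k)"
  unfolding \<gamma>_def
  by (intro Ck_intros b_C1 Tw_C1 Ck_on_inverse open_U lam_C1) (use lam_pos in fastforce)

lemmas C1_intros = Ck_intros b_C1 Tw_C1 \<gamma>_C1 lam_C1

lemma lie_X_b: "p \<in> U \<Longrightarrow> lie (X m) (b j l) p = lie (X l) (b j m) p"
  unfolding b_def by (subst commutator) (auto intro: w_C1 lie_w_C1)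

lemma lie_Y_w: "q \<in> U \<Longrightarrow> lie (Y m) (w j) q = \<i> * b j m q"
  by (simp add: w_CR b_def)

text \<open>\<open>Y m (w j) = i X m (w j)\<close>, so \<open>Y m (b j l) = Y m (X l (w j))\<close> becomes
  \<open>i X l (X m (w j))\<close> up to the commutator of \<open>Y m\<close> and \<open>X l\<close>.\<close>

lemma Zb_b:
  assumes p: "p \<in> U" shows "Zb m (b j l) p = (if m = l then 2 * \<i> * Tw j p else 0)"
proof -
  have "lie (Y m) (b j l) p = lie (X l) (lie (Y m) (w j)) p + bracket (Y m) (X l) *\<^sub>R Tw j p"
    unfolding b_def Tw_def by (rule commutator[OF w_C1 lie_w_C1 p])
  also have "lie (X l) (lie (Y m) (w j)) p = lie (X l) (\<lambda>q. \<i> * b j m q) p"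
    by (rule lie_cong[OF open_U p]) (rule lie_Y_w)
  also have "\<dots> = \<i> * lie (X m) (b j l) p"
    using p by (simp add: lie_cmult b_C1 lie_X_b[of p m])
  finally show ?thesis by (auto simp: Zb_def scaleR_conv_of_real algebra_simps)
qed

text \<open>\<open>T\<close> commutes with the fields, so \<open>T (w j)\<close> is again a CR function.\<close>

lemma Z_Tw:
  assumes p: "p \<in> U" shows "Zb l (Tw j) p = 0" and "Zd l (Tw j) p = lie None (b j l) p"
proof -
  have x: "lie (X l) (Tw j) p = lie None (b j l) p"
    unfolding Tw_def b_def by (subst commutator[OF w_C1 lie_w_C1 p]) simp
  have "lie (Y l) (Tw j) p = lie None (lie (Y l) (w j)) p"
    unfolding Tw_def by (subst commutator[OF w_C1 lie_w_C1 p]) simp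
  also have "\<dots> = lie None (\<lambda>q. \<i> * b j l q) p"
    by (rule lie_cong[OF open_U p]) (rule lie_Y_w)
  also have "\<dots> = \<i> * lie None (b j l) p"
    using p by (simp add: lie_cmult b_C1)
  finally show "Zb l (Tw j) p = 0" "Zd l (Tw j) p = lie None (b j l) p"
    using x by (simp_all add: Zb_def Zd_def)
qed

lemma herm_b: "p \<in> U \<Longrightarrow> (\<Sum>j\<in>UNIV. cnj (b j k p) * b j l p) = (if k = l then of_real (lam p) else 0)"
  unfolding b_def by (rule herm)

lemma lam_nz: "p \<in> U \<Longrightarrow> complex_of_real (lam p) \<noteq> 0"
  using lam_pos by fastforce

lemma sum_\<gamma>: "p \<in> U \<Longrightarrow> (\<Sum>j\<in>UNIV. cnj (b j k p) * Tw j p) = of_real (lam p) * \<gamma> k p"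
  using lam_nz by (simp add: \<gamma>_def)

lemma Tw_eq: "p \<in> U \<Longrightarrow> Tw j p = (\<Sum>k\<in>UNIV. b j k p * \<gamma> k p)"
  by (rule conformal_frame_expand[OF herm_b lam_nz sum_\<gamma>])

text \<open>These two equations say that \<open>Zb k (ln lam) = -2 i \<gamma> k\<close>.\<close>

lemma lie_XY_lam:
  assumes "p \<in> U"
  shows "lie (X k) lam p = lam p * (4 * Im (\<gamma> k p))" "lie (Y k) lam p = lam p * (- 4 * Re (\<gamma> k p))"
proof -
  have g: "Im (\<Sum>j\<in>UNIV. cnj (b j k p) * Tw j p) = lam p * Im (\<gamma> k p)"
      "Re (\<Sum>j\<in>UNIV. cnj (b j k p) * Tw j p) = lam p * Re (\<gamma> k p)"
    unfolding sum_\<gamma>[OF assms] by simp_all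
  show "lie (X k) lam p = lam p * (4 * Im (\<gamma> k p))"
    using g(1) unfolding lie_lam[OF assms] by (simp only: b_def[symmetric] Tw_def[symmetric] Im_sum)
  have "lie (Y k) lam p = 4 * (\<Sum>j\<in>UNIV. Im (cnj (\<i> * b j k p) * Tw j p))"
    unfolding lie_lam[OF assms] by (simp only: lie_Y_w[OF assms] Tw_def[symmetric])
  also have "\<dots> = - 4 * Re (\<Sum>j\<in>UNIV. cnj (b j k p) * Tw j p)"
    by (simp add: sum_negf[symmetric] algebra_simps)
  finally show "lie (Y k) lam p = lam p * (- 4 * Re (\<gamma> k p))" unfolding g by simp
qed

lemma Zd_lam:
  assumes p: "p \<in> U"
  shows "Zd k (\<lambda>q. of_real (lam q)) p = 2 * \<i> * of_real (lam p) * cnj (\<gamma> k p)"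
  unfolding Zd_def lie_of_real[OF p lam_C1] lie_XY_lam[OF p]
  by (simp add: complex_eq_iff)

text \<open>Apply \<open>Zd m\<close> to the relation \<open>herm_b\<close>. The term in which the conjugated factor is differentiated is
  known from \<open>Zb_b\<close>, and since \<open>b\<close> is unitary up to a factor the other term determines
  \<open>Zd m (b j l)\<close>.\<close>

lemma Zd_b:
  assumes p: "p \<in> U"
  shows "Zd m (b j l) p = 2 * \<i> * (b j l p * cnj (\<gamma> m p) + b j m p * cnj (\<gamma> l p))"
proof -
  have "(\<Sum>j\<in>UNIV. cnj (b j k p) * Zd m (b j l) p) = of_real (lam p) *
      (2 * \<i> * ((if k = l then cnj (\<gamma> m p) else 0) + (if k = m then cnj (\<gamma> l p) else 0)))" for k
  proof -
    have "Zd m (\<lambda>q. \<Sum>j\<in>UNIV. cnj (b j k q) * b j l q) p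
        = Zd m (\<lambda>q. if k = l then of_real (lam q) else 0) p"
      by (rule Z_cong(1)[OF p]) (rule herm_b)
    also have "\<dots> = (if k = l then 2 * \<i> * of_real (lam p) * cnj (\<gamma> m p) else 0)"
      using Zd_lam[OF p, of m] by (cases "k = l") (simp_all add: Zd_def[of m "\<lambda>q. 0"])
    finally have 1: "(\<Sum>j\<in>UNIV. cnj (b j k p) * Zd m (b j l) p) + (\<Sum>j\<in>UNIV. cnj (Zb m (b j k) p) * b j l p)
        = (if k = l then 2 * \<i> * of_real (lam p) * cnj (\<gamma> m p) else 0)"
      using p by (simp add: Z_sum Z_mult Z_cnj C1_intros sum.distrib)
    have "(\<Sum>j\<in>UNIV. cnj (Tw j p) * b j l p) = cnj (\<Sum>j\<in>UNIV. cnj (b j l p) * Tw j p)"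
      by (simp add: mult.commute)
    also have "\<dots> = of_real (lam p) * cnj (\<gamma> l p)" unfolding sum_\<gamma>[OF p] by simp
    finally have "(\<Sum>j\<in>UNIV. cnj (Zb m (b j k) p) * b j l p)
        = (if k = m then -2 * \<i> * of_real (lam p) * cnj (\<gamma> l p) else 0)"
      by (simp add: Zb_b[OF p] mult.assoc sum_negf sum_distrib_left[symmetric])
    with 1 show ?thesis by (auto simp: algebra_simps add_eq_0_iff split: if_splits)
  qed
  from conformal_frame_expand[OF herm_b[OF p] lam_nz[OF p] this]
  have "Zd m (b j l) p = (\<Sum>k\<in>UNIV. b j k p *
      (2 * \<i> * ((if k = l then cnj (\<gamma> m p) else 0) + (if k = m then cnj (\<gamma> l p) else 0))))" .
  also have "\<dots> = 2 * \<i> * (b j l p * cnj (\<gamma> m p) + b j m p * cnj (\<gamma> l p))"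
    by (simp add: distrib_left sum.distrib mult_delta_right)
  finally show ?thesis .
qed

text \<open>This expresses that \<open>T (w j) = (\<Sum>k. b j k \<gamma> k)\<close> is a CR function.\<close>

lemma Zb_\<gamma>:
  assumes p: "p \<in> U" shows "Zb m (\<gamma> k) p = -2 * \<i> * \<gamma> m p * \<gamma> k p"
proof -
  have "(\<Sum>k\<in>UNIV. b j k p * (Zb m (\<gamma> k) p + 2 * \<i> * \<gamma> m p * \<gamma> k p)) = 0" for j
  proof -
    have "Zb m (Tw j) p = Zb m (\<lambda>q. \<Sum>k\<in>UNIV. b j k q * \<gamma> k q) p"
      by (rule Z_cong(2)[OF p Tw_eq])
    then have "0 = Zb m (\<lambda>q. \<Sum>k\<in>UNIV. b j k q * \<gamma> k q) p" by (simp add: Z_Tw p)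
    also have "\<dots> = (\<Sum>k\<in>UNIV. b j k p * Zb m (\<gamma> k) p) + (\<Sum>k\<in>UNIV. Zb m (b j k) p * \<gamma> k p)"
      using p by (simp add: Z_sum Z_mult C1_intros sum.distrib)
    also have "(\<Sum>k\<in>UNIV. Zb m (b j k) p * \<gamma> k p) = 2 * \<i> * Tw j p * \<gamma> m p"
      by (simp add: Zb_b[OF p] if_distrib[of "\<lambda>x. x * _"] cong: if_cong)
    also have "\<dots> = (\<Sum>k\<in>UNIV. b j k p * (2 * \<i> * \<gamma> m p * \<gamma> k p))"
      unfolding Tw_eq[OF p] by (simp add: sum_distrib_left sum_distrib_right algebra_simps)
    finally show ?thesis by (simp add: distrib_left sum.distrib)
  qed
  from conformal_frame_inj[OF herm_b[OF p] lam_nz[OF p] this]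
  show ?thesis by (simp add: add_eq_0_iff)
qed

definition "N p = (\<Sum>m\<in>UNIV. cnj (\<gamma> m p) * \<gamma> m p)"

text \<open>Here \<open>T (b j l) = Zd l (T (w j))\<close> is expanded.\<close>

lemma lie_T_b:
  assumes p: "p \<in> U"
  shows "lie None (b j l) p = (\<Sum>k\<in>UNIV. b j k p * Zd l (\<gamma> k) p)
    + 2 * \<i> * cnj (\<gamma> l p) * Tw j p + 2 * \<i> * b j l p * N p"
proof -
  have "Zd l (Tw j) p = Zd l (\<lambda>q. \<Sum>k\<in>UNIV. b j k q * \<gamma> k q) p"
    by (rule Z_cong(1)[OF p Tw_eq])
  then have "lie None (b j l) p = Zd l (\<lambda>q. \<Sum>k\<in>UNIV. b j k q * \<gamma> k q) p" by (simp add: Z_Tw p)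
  also have "\<dots> = (\<Sum>k\<in>UNIV. b j k p * Zd l (\<gamma> k) p)
      + (\<Sum>k\<in>UNIV. 2 * \<i> * (b j k p * cnj (\<gamma> l p) + b j l p * cnj (\<gamma> k p)) * \<gamma> k p)"
    using p by (simp add: Z_sum Z_mult C1_intros sum.distrib Zd_b)
  also have "(\<Sum>k\<in>UNIV. 2 * \<i> * (b j k p * cnj (\<gamma> l p) + b j l p * cnj (\<gamma> k p)) * \<gamma> k p)
      = 2 * \<i> * cnj (\<gamma> l p) * Tw j p + 2 * \<i> * b j l p * N p"
    unfolding Tw_eq[OF p] N_def by (simp add: sum_distrib_left sum.distrib[symmetric] algebra_simps)
  finally show ?thesis by simp
qed

lemma C1_Zd_b: "C1 (Zd m (b j l))"
  by (rule C1_cong[of "\<lambda>q. 2 * \<i> * (b j l q * cnj (\<gamma> m q) + b j m q * cnj (\<gamma> l q))"])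
    (intro C1_intros, simp add: Zd_b)

lemma C1_Zb_b: "C1 (Zb m (b j l))"
  by (rule C1_cong[of "\<lambda>q. (if m = l then 2 * \<i> else 0) * Tw j q"])
    (intro C1_intros, simp add: Zb_b)

text \<open>A second expression for \<open>T (b j k)\<close> comes from \<open>[Zd k, Zb k] = -2 i T\<close> applied to
  \<open>b j k\<close>. Comparing it with \<open>lie_T_b\<close> yields a linear equation for the numbers
  \<open>Zd k (\<gamma> m)\<close>.\<close>

lemma Zd_\<gamma>_gen:
  assumes p: "p \<in> U"
  shows "Zd k (\<gamma> m) p = (if m = k then cnj (Zd k (\<gamma> k) p) - 2 * \<i> * N p else 0)"
proof -
  have "(\<Sum>m\<in>UNIV. b j m p * (Zd k (\<gamma> m) p
      - (if m = k then cnj (Zd k (\<gamma> k) p) - 2 * \<i> * N p else 0))) = 0" for j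
  proof -
    have C: "C1 (lie (X k) (b j k))" "C1 (lie (Y k) (b j k))"
      by (simp_all only: lie_X_Z[abs_def] lie_Y_Z[abs_def]) (intro C1_intros C1_Zd_b C1_Zb_b)+
    have 1: "Zd k (Zb k (b j k)) p = 2 * \<i> * lie None (b j k) p"
    proof -
      have "Zd k (Zb k (b j k)) p = Zd k (\<lambda>q. 2 * \<i> * Tw j q) p"
        by (rule Z_cong(1)[OF p]) (simp add: Zb_b)
      then show ?thesis by (simp add: Z_cmult Tw_C1 p Z_Tw)
    qed
    have 2: "Zb k (Zd k (b j k)) p = 4 * \<i> * (b j k p * cnj (Zd k (\<gamma> k) p) + 2 * \<i> * Tw j p * cnj (\<gamma> k p))"
    proof -
      have "Zb k (Zd k (b j k)) p = Zb k (\<lambda>q. 4 * \<i> * (b j k q * cnj (\<gamma> k q))) p"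
        by (rule Z_cong(2)[OF p]) (simp add: Zd_b)
      then show ?thesis by (simp add: Z_cmult Z_mult Z_cnj C1_intros p Zb_b)
    qed
    have "4 * \<i> * lie None (b j k) p = Zb k (Zd k (b j k)) p"
      using Z_commutator[OF b_C1 C p] unfolding 1 by (simp add: algebra_simps)
    then have "lie None (b j k) p = b j k p * cnj (Zd k (\<gamma> k) p) + 2 * \<i> * Tw j p * cnj (\<gamma> k p)"
      unfolding 2 by simp
    then show ?thesis
      unfolding lie_T_b[OF p] by (simp add: right_diff_distrib sum_subtractf mult_delta_right) (simp add: algebra_simps)
  qed
  from conformal_frame_inj[OF herm_b[OF p] lam_nz[OF p] this, of m]
  show ?thesis by simp
qed

text \<open>The functions \<open>\<tau>\<close> and \<open>\<rho>\<close> are only known to be continuous until \<open>\<tau>_C1\<close> below.\<close>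

definition "L p = ln (lam p)"
definition "\<tau> = lie None L"
definition "\<rho> p = of_real (\<tau> p / 2) - \<i> * N p"

lemma has_lie_L:
  assumes p: "p \<in> U" shows "has_lie i L p (lie i lam p / lam p)"
proof -
  have "has_lie i lam p (lie i lam p)" by (rule lie_differentiableI[OF lam_C1 p])
  then have "((\<lambda>s. lam (p + s *\<^sub>R lfield i p)) has_real_derivative lie i lam p) (at 0)"
    by (simp add: has_lie_def has_real_derivative_iff_has_vector_derivative)
  moreover have "(ln has_real_derivative 1 / lam p) (at (lam (p + 0 *\<^sub>R lfield i p)))"
    using DERIV_ln_divide[OF lam_pos[OF p]] by simp
  ultimately have "((\<lambda>s. ln (lam (p + s *\<^sub>R lfield i p))) has_real_derivative
      (1 / lam p) * lie i lam p) (at 0)"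
    by (rule DERIV_chain2[where f = ln and g = "\<lambda>s. lam (p + s *\<^sub>R lfield i p)", rotated])
  then show ?thesis
    by (simp add: has_lie_def L_def has_real_derivative_iff_has_vector_derivative)
qed

lemma L_C1: "C1 L"
proof (rule C1_from_lie[OF open_U has_lie_L])
  show "continuous_on U (\<lambda>p. lie i lam p / lam p)" for i
  proof (intro continuous_on_divide)
    show "continuous_on U (lie i lam)" by (rule C1_lie_cont[OF lam_C1])
    show "continuous_on U lam" using Ck_on_SucD[OF lam_C1] by simp
  qed (use lam_pos in fastforce)
qed

lemma lie_XY_L:
  assumes p: "p \<in> U" shows "lie (X k) L p = 4 * Im (\<gamma> k p)" "lie (Y k) L p = - 4 * Re (\<gamma> k p)"
  using has_lie_eq[OF has_lie_L[OF p]] lam_pos[OF p] by (simp_all add: lie_XY_lam[OF p])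

lemma lie_L_C1: "C1 (lie (X k) L)" "C1 (lie (Y k) L)"
proof -
  show "C1 (lie (X k) L)"
    by (rule C1_cong[of "\<lambda>q. 4 * Im (\<gamma> k q)"]) (intro C1_intros, simp add: lie_XY_L)
  show "C1 (lie (Y k) L)"
    by (rule C1_cong[of "\<lambda>q. - 4 * Re (\<gamma> k q)"]) (intro C1_intros, simp add: lie_XY_L)
qed

text \<open>The commutator of \<open>Zd k\<close> and \<open>Zb k\<close> on \<open>L = ln lam\<close>, whose first horizontal derivatives are
  \<open>Zb k L = -2 i \<gamma> k\<close> and its conjugate.\<close>

lemma Re_Zd_\<gamma>: assumes p: "p \<in> U" shows "Re (Zd k (\<gamma> k) p) = \<tau> p / 2"
proof -
  define cL where "cL q = complex_of_real (L q)" for q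
  have cL: "lie i cL q = of_real (lie i L q)" if "q \<in> U" for i q
    unfolding cL_def by (rule lie_of_real[OF that L_C1])
  have "Zd k (Zb k cL) p - Zb k (Zd k cL) p = -2 * \<i> * lie None cL p"
  proof (rule Z_commutator[OF _ _ _ p])
    show "C1 cL" unfolding cL_def by (intro C1_intros L_C1)
    show "C1 (lie (X k) cL)" by (rule C1_cong[OF Ck_on_of_real[OF open_U lie_L_C1(1)]]) (simp add: cL)
    show "C1 (lie (Y k) cL)" by (rule C1_cong[OF Ck_on_of_real[OF open_U lie_L_C1(2)]]) (simp add: cL)
  qed
  moreover have "Zd k (Zb k cL) p = Zd k (\<lambda>q. -2 * \<i> * \<gamma> k q) p"
    by (rule Z_cong(1)[OF p]) (simp add: Zb_def cL lie_XY_L complex_eq_iff)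
  moreover have "Zb k (Zd k cL) p = Zb k (\<lambda>q. 2 * \<i> * cnj (\<gamma> k q)) p"
    by (rule Z_cong(2)[OF p]) (simp add: Zd_def cL lie_XY_L complex_eq_iff)
  moreover have "Zd k (\<lambda>q. -2 * \<i> * \<gamma> k q) p = -2 * \<i> * Zd k (\<gamma> k) p"
    by (rule Z_cmult(1)[OF \<gamma>_C1 p])
  moreover have "Zb k (\<lambda>q. 2 * \<i> * cnj (\<gamma> k q)) p = 2 * \<i> * cnj (Zd k (\<gamma> k) p)"
    by (simp add: Z_cmult Z_cnj C1_intros p)
  ultimately have "-2 * \<i> * Zd k (\<gamma> k) p - 2 * \<i> * cnj (Zd k (\<gamma> k) p) = -2 * \<i> * of_real (\<tau> p)"
    by (simp only: cL[OF p] \<tau>_def)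
  then show ?thesis by (simp add: complex_eq_iff)
qed

lemma N_real: "Im (N p) = 0"
  by (simp add: N_def)

text \<open>The preceding lemmas determine the imaginary part and the real part.\<close>

lemma Zd_\<gamma>: assumes p: "p \<in> U" shows "Zd k (\<gamma> m) p = (if m = k then \<rho> p else 0)"
proof -
  have "Zd k (\<gamma> k) p = cnj (Zd k (\<gamma> k) p) - 2 * \<i> * N p"
    using Zd_\<gamma>_gen[OF p, of k k] by simp
  then have "Im (Zd k (\<gamma> k) p) = - Re (N p)" by (simp add: complex_eq_iff)
  then have "Zd k (\<gamma> k) p = \<rho> p"
    using Re_Zd_\<gamma>[OF p] by (simp add: complex_eq_iff \<rho>_def N_real)
  then show ?thesis using Zd_\<gamma>_gen[OF p, of k m] by auto
qed

lemma lie_XY_\<gamma>: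
  assumes p: "p \<in> U"
  shows "lie (X k) (\<gamma> m) p = (if m = k then \<rho> p else 0) - 2 * \<i> * \<gamma> k p * \<gamma> m p"
    and "lie (Y k) (\<gamma> m) p = \<i> * (if m = k then \<rho> p else 0) - 2 * \<gamma> k p * \<gamma> m p"
  by (simp_all add: lie_X_Z lie_Y_Z Zd_\<gamma>[OF p] Zb_\<gamma>[OF p] algebra_simps)

lemma N_C1: "C1 N"
  unfolding N_def by (intro C1_intros)

lemma Zb_N: assumes p: "p \<in> U" shows "Zb k N p = \<gamma> k p * \<rho> p"
proof -
  have "Zb k N p = (\<Sum>m\<in>UNIV. cnj (\<gamma> m p) * Zb k (\<gamma> m) p + cnj (Zd k (\<gamma> m) p) * \<gamma> m p)"
    unfolding N_def using p by (simp add: Z_sum Z_mult Z_cnj C1_intros)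
  also have "\<dots> = (\<Sum>m\<in>UNIV. cnj (\<gamma> m p) * (-2 * \<i> * \<gamma> k p * \<gamma> m p))
      + (\<Sum>m\<in>UNIV. cnj (if m = k then \<rho> p else 0) * \<gamma> m p)"
    unfolding sum.distrib Zd_\<gamma>[OF p] Zb_\<gamma>[OF p] ..
  also have "(\<Sum>m\<in>UNIV. cnj (if m = k then \<rho> p else 0) * \<gamma> m p) = cnj (\<rho> p) * \<gamma> k p"
    by (simp add: if_distrib[of "\<lambda>x. cnj x * _"] cong: if_cong)
  also have "(\<Sum>m\<in>UNIV. cnj (\<gamma> m p) * (-2 * \<i> * \<gamma> k p * \<gamma> m p)) = -2 * \<i> * \<gamma> k p * N p"
    unfolding N_def by (simp add: sum_distrib_left algebra_simps)
  also have "-2 * \<i> * \<gamma> k p * N p + cnj (\<rho> p) * \<gamma> k p = \<gamma> k p * (cnj (\<rho> p) - 2 * \<i> * N p)"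
    by (simp add: algebra_simps)
  also have "cnj (\<rho> p) - 2 * \<i> * N p = \<rho> p"
    by (simp add: \<rho>_def complex_eq_iff N_real)
  finally show ?thesis .
qed

lemma lie_XY_N:
  assumes p: "p \<in> U"
  shows "lie (X k) N p = of_real (2 * Re (\<gamma> k p * \<rho> p))" "lie (Y k) N p = of_real (2 * Im (\<gamma> k p * \<rho> p))"
proof -
  have r: "Im (lie i N p) = 0" for i
    using lie_Im[OF p N_C1, of i] by (simp add: N_real)
  show "lie (X k) N p = of_real (2 * Re (\<gamma> k p * \<rho> p))" "lie (Y k) N p = of_real (2 * Im (\<gamma> k p * \<rho> p))"
    using Zb_N[OF p, of k] r unfolding Zb_def by (auto simp: complex_eq_iff)
qed

text \<open>\<open>T L\<close> can be differentiated along a horizontal field \<open>V\<close>, because \<open>V L\<close> is C^1 and commuting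
  the fields gives \<open>V (T L) = T (V L)\<close>.\<close>

lemma has_lie_XY_\<tau>:
  assumes p: "p \<in> U"
  shows "has_lie (X k) \<tau> p (4 * Im (lie None (\<gamma> k) p))" "has_lie (Y k) \<tau> p (- 4 * Re (lie None (\<gamma> k) p))"
proof -
  have "lie None (lie (X k) L) p = lie None (\<lambda>q. 4 * Im (\<gamma> k q)) p"
    by (rule lie_cong[OF open_U p]) (rule lie_XY_L)
  also have "\<dots> = 4 * Im (lie None (\<gamma> k) p)"
    using p by (simp add: lie_cmult lie_Im C1_intros)
  finally show "has_lie (X k) \<tau> p (4 * Im (lie None (\<gamma> k) p))"
    using lie_commutator[OF open_U p L_C1 lie_L_C1(1)[of k], of None] by (simp add: \<tau>_def)
  have "lie None (lie (Y k) L) p = lie None (\<lambda>q. (- 4) * Re (\<gamma> k q)) p"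
    by (rule lie_cong[OF open_U p]) (simp add: lie_XY_L)
  also have "\<dots> = - 4 * Re (lie None (\<gamma> k) p)"
    using p by (subst lie_cmult) (simp_all add: lie_Re C1_intros)
  finally show "has_lie (Y k) \<tau> p (- 4 * Re (lie None (\<gamma> k) p))"
    using lie_commutator[OF open_U p L_C1 lie_L_C1(2)[of k], of None] by (simp add: \<tau>_def)
qed

text \<open>Formally this is the commutator of \<open>Zd k\<close> and \<open>Zb k\<close> on \<open>\<gamma> k\<close>; but
  \<open>Zd k (\<gamma> k) = \<rho>\<close> is not known to be C^1. However, \<open>X k\<close> applied to the imaginary part of
  \<open>\<gamma> k\<close> and \<open>Y k\<close> applied to its real part do not contain \<open>\<tau>\<close>, hence are C^1, and the real
  commutators based on them can be used. They express a horizontal derivative of \<open>\<tau>\<close> in two ways,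
  the other one being \<open>has_lie_XY_\<tau>\<close>.\<close>

lemma lie_T_\<gamma>:
  assumes p: "p \<in> U" shows "lie None (\<gamma> k) p = \<gamma> k p * \<rho> p"
proof -
  define g r T where "g = \<gamma> k p" and "r = \<rho> p" and "T = lie None (\<gamma> k) p"
  define sq where "sq q = \<gamma> k q * \<gamma> k q" for q
  have sq_C1: "C1 sq" unfolding sq_def by (intro C1_intros)
  have sq: "lie (X k) sq p = 2 * g * (r - 2 * \<i> * g * g)" "lie (Y k) sq p = 2 * g * (\<i> * r - 2 * g * g)"
    unfolding sq_def using p by (simp_all add: lie_mult C1_intros lie_XY_\<gamma> g_def r_def algebra_simps)
  have XIm: "lie (X k) (\<lambda>q. Im (\<gamma> k q)) q = - Re (N q) - 2 * Re (sq q)"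
    and YIm: "lie (Y k) (\<lambda>q. Im (\<gamma> k q)) q = \<tau> q / 2 - 2 * Im (sq q)"
    and XRe: "lie (X k) (\<lambda>q. Re (\<gamma> k q)) q = \<tau> q / 2 + 2 * Im (sq q)"
    and YRe: "lie (Y k) (\<lambda>q. Re (\<gamma> k q)) q = Re (N q) - 2 * Re (sq q)"
    if "q \<in> U" for q
    using that by (simp_all add: lie_Im lie_Re C1_intros lie_XY_\<gamma> \<rho>_def N_real sq_def)
  have C1: "C1 (\<lambda>q. - Re (N q) - 2 * Re (sq q))" "C1 (\<lambda>q. Re (N q) - 2 * Re (sq q))"
    by (intro C1_intros N_C1 sq_C1)+
  have "has_lie (X k) (lie (Y k) (\<lambda>q. Im (\<gamma> k q))) p
      (lie (Y k) (lie (X k) (\<lambda>q. Im (\<gamma> k q))) p + bracket (X k) (Y k) *\<^sub>R lie None (\<lambda>q. Im (\<gamma> k q)) p)"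
    by (rule lie_commutator[OF open_U p Ck_on_Im[OF open_U \<gamma>_C1] C1_cong[OF C1(1) XIm[symmetric]]])
  also have "lie None (\<lambda>q. Im (\<gamma> k q)) p = Im T"
    unfolding T_def by (rule lie_Im[OF p \<gamma>_C1])
  also have "lie (Y k) (lie (X k) (\<lambda>q. Im (\<gamma> k q))) p = lie (Y k) (\<lambda>q. - Re (N q) - 2 * Re (sq q)) p"
    by (rule lie_cong[OF open_U p]) (rule XIm)
  also have "\<dots> = - 2 * Im (g * r) - 2 * Re (2 * g * (\<i> * r - 2 * g * g))"
  proof -
    \<comment> \<open>here and below the summands with a factor \<open>0\<close> are derivatives of constant factors\<close>
    have "has_lie (Y k) (\<lambda>q. - Re (N q) - 2 * Re (sq q)) p (- Re (lie (Y k) N p) - (2 * Re (lie (Y k) sq p) + 0 * Re (sq p)))"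
      by (intro has_lie_intros lie_differentiableI N_C1 sq_C1 p)
    from has_lie_eq[OF this] show ?thesis by (simp add: lie_XY_N[OF p] sq g_def r_def)
  qed
  also have "has_lie (X k) (lie (Y k) (\<lambda>q. Im (\<gamma> k q))) p = has_lie (X k) (\<lambda>q. (1/2) * \<tau> q - 2 * Im (sq q)) p"
    by (rule ext, rule has_lie_cong[OF open_U p]) (simp add: YIm)
  finally have 1: "has_lie (X k) (\<lambda>q. (1/2) * \<tau> q - 2 * Im (sq q)) p
      (- 2 * Im (g * r) - 2 * Re (2 * g * (\<i> * r - 2 * g * g)) - 4 * Im T)" by simp
  have "has_lie (X k) (\<lambda>q. (1/2) * \<tau> q - 2 * Im (sq q)) p
      ((1/2) * (4 * Im T) + 0 * \<tau> p - (2 * Im (lie (X k) sq p) + 0 * Im (sq p)))"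
    unfolding T_def by (intro has_lie_intros has_lie_XY_\<tau> lie_differentiableI sq_C1 p)
  from has_lie_unique[OF this 1] have ImT: "Im T = Im (g * r)"
    by (simp add: sq algebra_simps)
  have "has_lie (Y k) (lie (X k) (\<lambda>q. Re (\<gamma> k q))) p
      (lie (X k) (lie (Y k) (\<lambda>q. Re (\<gamma> k q))) p + bracket (Y k) (X k) *\<^sub>R lie None (\<lambda>q. Re (\<gamma> k q)) p)"
    by (rule lie_commutator[OF open_U p Ck_on_Re[OF open_U \<gamma>_C1] C1_cong[OF C1(2) YRe[symmetric]]])
  also have "lie None (\<lambda>q. Re (\<gamma> k q)) p = Re T"
    unfolding T_def by (rule lie_Re[OF p \<gamma>_C1])
  also have "lie (X k) (lie (Y k) (\<lambda>q. Re (\<gamma> k q))) p = lie (X k) (\<lambda>q. Re (N q) - 2 * Re (sq q)) p"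
    by (rule lie_cong[OF open_U p]) (rule YRe)
  also have "\<dots> = 2 * Re (g * r) - 2 * Re (2 * g * (r - 2 * \<i> * g * g))"
  proof -
    have "has_lie (X k) (\<lambda>q. Re (N q) - 2 * Re (sq q)) p (Re (lie (X k) N p) - (2 * Re (lie (X k) sq p) + 0 * Re (sq p)))"
      by (intro has_lie_intros lie_differentiableI N_C1 sq_C1 p)
    from has_lie_eq[OF this] show ?thesis by (simp add: lie_XY_N[OF p] sq g_def r_def)
  qed
  also have "has_lie (Y k) (lie (X k) (\<lambda>q. Re (\<gamma> k q))) p = has_lie (Y k) (\<lambda>q. (1/2) * \<tau> q + 2 * Im (sq q)) p"
    by (rule ext, rule has_lie_cong[OF open_U p]) (simp add: XRe)
  finally have 2: "has_lie (Y k) (\<lambda>q. (1/2) * \<tau> q + 2 * Im (sq q)) p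
      (2 * Re (g * r) - 2 * Re (2 * g * (r - 2 * \<i> * g * g)) + 4 * Re T)" by simp
  have "has_lie (Y k) (\<lambda>q. (1/2) * \<tau> q + 2 * Im (sq q)) p
      ((1/2) * (- 4 * Re T) + 0 * \<tau> p + (2 * Im (lie (Y k) sq p) + 0 * Im (sq p)))"
    unfolding T_def by (intro has_lie_intros has_lie_XY_\<tau> lie_differentiableI sq_C1 p)
  from has_lie_unique[OF this 2] have ReT: "Re T = Re (g * r)"
    by (simp add: sq algebra_simps)
  show ?thesis using ImT ReT by (simp add: complex_eq_iff T_def g_def r_def)
qed

text \<open>By now \<open>T (\<gamma> k) = \<gamma> k \<rho>\<close> has a continuous derivative \<open>h\<close> along \<open>X k\<close>, so
  \<open>X k (\<gamma> k) = \<rho> - 2 i \<gamma> k \<gamma> k\<close> has the derivative \<open>h\<close> along \<open>T\<close>. Hence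
  \<open>T \<rho> = \<rho>^2\<close>, and \<open>\<tau>\<close> is twice the real part of \<open>\<rho>\<close>.\<close>

lemma has_lie_T_\<tau>:
  assumes p: "p \<in> U" shows "has_lie None \<tau> p (2 * Re ((\<rho> p)\<^sup>2))"
proof -
  \<comment> \<open>any index serves, as \<open>\<rho>\<close> is independent of it\<close>
  define k :: 'n where "k = undefined"
  define h where "h q = \<gamma> k q * (-2 * \<i> * \<gamma> k q * \<rho> q) + (\<rho> q - 2 * \<i> * \<gamma> k q * \<gamma> k q) * \<rho> q" for q
  have \<rho>_alt: "\<rho> = (\<lambda>q. of_real (\<tau> q) * (1/2) - \<i> * N q)" by (auto simp: \<rho>_def)
  have \<tau>_cont: "continuous_on U \<tau>"
    unfolding \<tau>_def by (rule C1_lie_cont[OF L_C1])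
  have N_cont: "continuous_on U N" and \<gamma>_cont: "continuous_on U (\<gamma> k)"
    using Ck_on_SucD[OF N_C1] Ck_on_SucD[OF \<gamma>_C1] by simp_all
  have "has_lie None (lie (X k) (\<gamma> k)) p (h p)"
  proof (rule lie_commute_T[OF open_U p \<gamma>_C1])
    show "continuous_on U h"
      unfolding h_def \<rho>_alt by (intro continuous_intros \<tau>_cont N_cont \<gamma>_cont)
    fix x assume x: "x \<in> U"
    have "has_lie (X k) \<rho> x (of_real (\<tau> x) * 0 + of_real (4 * Im (lie None (\<gamma> k) x)) * (1/2) - (\<i> * lie (X k) N x + 0 * N x))"
      unfolding \<rho>_alt by (intro has_lie_intros has_lie_XY_\<tau> lie_differentiableI N_C1 x)
    also have "of_real (\<tau> x) * 0 + of_real (4 * Im (lie None (\<gamma> k) x)) * (1/2) - (\<i> * lie (X k) N x + 0 * N x)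
        = -2 * \<i> * \<gamma> k x * \<rho> x"
      by (simp add: lie_T_\<gamma> lie_XY_N x complex_eq_iff algebra_simps)
    finally have "has_lie (X k) (\<lambda>q. \<gamma> k q * \<rho> q) x (\<gamma> k x * (-2 * \<i> * \<gamma> k x * \<rho> x) + lie (X k) (\<gamma> k) x * \<rho> x)"
      by (intro has_lie_intros lie_differentiableI \<gamma>_C1 x)
    then have "has_lie (X k) (\<lambda>q. \<gamma> k q * \<rho> q) x (h x)"
      by (simp add: h_def lie_XY_\<gamma> x)
    then show "has_lie (X k) (lie None (\<gamma> k)) x (h x)"
      using has_lie_cong[OF open_U x, of "lie None (\<gamma> k)" "\<lambda>q. \<gamma> k q * \<rho> q"] by (simp add: lie_T_\<gamma>)
  qed
  then have "has_lie None (\<lambda>q. \<rho> q - 2 * \<i> * \<gamma> k q * \<gamma> k q) p (h p)"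
    using has_lie_cong[OF open_U p, of "lie (X k) (\<gamma> k)" "\<lambda>q. \<rho> q - 2 * \<i> * \<gamma> k q * \<gamma> k q"] by (simp add: lie_XY_\<gamma>)
  then have "has_lie None (\<lambda>q. 2 * Re ((\<rho> q - 2 * \<i> * \<gamma> k q * \<gamma> k q) + 2 * \<i> * (\<gamma> k q)\<^sup>2)) p
      (2 * Re (h p + (2 * \<i> * (2 * \<gamma> k p * lie None (\<gamma> k) p) + 0 * (\<gamma> k p)\<^sup>2)) + 0 * Re ((\<rho> p - 2 * \<i> * \<gamma> k p * \<gamma> k p) + 2 * \<i> * (\<gamma> k p)\<^sup>2))"
    by (intro has_lie_intros lie_differentiableI \<gamma>_C1 p)
  also have "(\<lambda>q. 2 * Re ((\<rho> q - 2 * \<i> * \<gamma> k q * \<gamma> k q) + 2 * \<i> * (\<gamma> k q)\<^sup>2)) = \<tau>"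
    by (auto simp: \<rho>_def N_real power2_eq_square)
  also have "2 * Re (h p + (2 * \<i> * (2 * \<gamma> k p * lie None (\<gamma> k) p) + 0 * (\<gamma> k p)\<^sup>2)) + 0 * Re ((\<rho> p - 2 * \<i> * \<gamma> k p * \<gamma> k p) + 2 * \<i> * (\<gamma> k p)\<^sup>2)
      = 2 * Re ((\<rho> p)\<^sup>2)"
    by (simp add: h_def lie_T_\<gamma>[OF p] power2_eq_square algebra_simps)
  finally show ?thesis .
qed

lemma \<tau>_C1: "C1 \<tau>"
proof -
  define h where "h i q = (case i of None \<Rightarrow> 2 * Re ((\<rho> q)\<^sup>2)
    | Some (Inl k) \<Rightarrow> 4 * Im (\<gamma> k q * \<rho> q) | Some (Inr k) \<Rightarrow> - 4 * Re (\<gamma> k q * \<rho> q))" for i q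
  have \<tau>_cont: "continuous_on U \<tau>"
    unfolding \<tau>_def by (rule C1_lie_cont[OF L_C1])
  have N_cont: "continuous_on U N" and \<gamma>_cont: "continuous_on U (\<gamma> k)" for k
    using Ck_on_SucD[OF N_C1] Ck_on_SucD[OF \<gamma>_C1] by simp_all
  have \<rho>_cont: "continuous_on U \<rho>"
    unfolding \<rho>_def[abs_def] by (intro continuous_intros \<tau>_cont N_cont) simp
  have c: "continuous_on U (h i)" for i
  proof (cases i)
    case None
    show ?thesis unfolding None h_def[abs_def] option.case by (intro continuous_intros \<rho>_cont)
  next
    case (Some l)
    show ?thesis
      by (cases l) (simp_all add: Some h_def[abs_def],
        (intro continuous_intros \<rho>_cont \<gamma>_cont)+)
  qed
  have "has_lie i \<tau> x (h i x)" if "x \<in> U" for i x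
    using has_lie_XY_\<tau>[OF that] has_lie_T_\<tau>[OF that] lie_T_\<gamma>[OF that]
    by (auto simp: h_def split: option.splits sum.splits)
  from C1_from_lie[OF open_U this c] show ?thesis .
qed

lemma lie_\<tau>:
  assumes "p \<in> U"
  shows "lie (X k) \<tau> p = 4 * Im (\<gamma> k p * \<rho> p)" "lie (Y k) \<tau> p = - 4 * Re (\<gamma> k p * \<rho> p)"
    "lie None \<tau> p = 2 * Re ((\<rho> p)\<^sup>2)"
  using has_lie_eq[OF has_lie_XY_\<tau>(1)[OF assms]] has_lie_eq[OF has_lie_XY_\<tau>(2)[OF assms]]
    has_lie_eq[OF has_lie_T_\<tau>[OF assms]] lie_T_\<gamma>[OF assms] by simp_all

text \<open>All derivatives of the listed functions along the fields are polynomials in these functions and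
  their conjugates; so each step of the induction gains one derivative.\<close>

lemma structure_functions_Ck:
  "(\<forall>j. Ck_on m U (w j)) \<and> (\<forall>j k. Ck_on m U (b j k)) \<and> (\<forall>k. Ck_on m U (\<gamma> k)) \<and> Ck_on m U \<tau>"
proof (induction m)
  case 0
  show ?case
    using w_C1[THEN Ck_on_SucD] b_C1[THEN Ck_on_SucD] \<gamma>_C1[THEN Ck_on_SucD] \<tau>_C1[THEN Ck_on_SucD]
    by (intro conjI allI)
next
  case (Suc m)
  note IH = Suc.IH[THEN conjunct1, rule_format] Suc.IH[THEN conjunct2, THEN conjunct1, rule_format]
    Suc.IH[THEN conjunct2, THEN conjunct2, THEN conjunct1, rule_format]
    Suc.IH[THEN conjunct2, THEN conjunct2, THEN conjunct2]
  have N: "Ck_on m U N" unfolding N_def by (intro Ck_intros IH)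
  have \<rho>: "Ck_on m U \<rho>"
    unfolding \<rho>_def[abs_def] divide_real_def by (intro Ck_intros IH N)
  have Tw: "Ck_on m U (Tw j)" for j
    by (rule Ck_on_cong[OF open_U, of "\<lambda>q. \<Sum>k\<in>UNIV. b j k q * \<gamma> k q"])
      (simp add: Tw_eq, intro Ck_intros IH)
  have Zdg: "Ck_on m U (Zd l (\<gamma> k))" for k l
    by (rule Ck_on_cong[OF open_U, of "\<lambda>q. if k = l then \<rho> q else 0"])
      (simp add: Zd_\<gamma>, cases "k = l", use \<rho> in simp_all)
  have Zbg: "Ck_on m U (Zb l (\<gamma> k))" for k l
    by (rule Ck_on_cong[OF open_U, of "\<lambda>q. -2 * \<i> * \<gamma> l q * \<gamma> k q"])
      (simp add: Zb_\<gamma>, intro Ck_intros IH)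
  have Zdb: "Ck_on m U (Zd l (b j k))" for j k l
    by (rule Ck_on_cong[OF open_U, of "\<lambda>q. 2 * \<i> * (b j k q * cnj (\<gamma> l q) + b j l q * cnj (\<gamma> k q))"])
      (simp add: Zd_b, intro Ck_intros IH)
  have Zbb: "Ck_on m U (Zb l (b j k))" for j k l
    by (rule Ck_on_cong[OF open_U, of "\<lambda>q. (if l = k then 2 * \<i> else 0) * Tw j q"])
      (simp add: Zb_b, intro Ck_intros Tw)
  have "Ck_on (Suc m) U (w j)" for j
  proof (rule Ck_SucI[OF w_C1])
    show "Ck_on m U (lie (X k) (w j))" for k using IH(2) by (simp add: b_def)
    show "Ck_on m U (lie (Y k) (w j))" for k
      by (rule Ck_on_cong[OF open_U, of "\<lambda>q. \<i> * b j k q"]) (simp add: lie_Y_w, intro Ck_intros IH)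
    show "Ck_on m U (lie None (w j))" using Tw by (simp add: Tw_def)
  qed
  moreover have "Ck_on (Suc m) U (b j k)" for j k
  proof (rule Ck_SucI[OF b_C1])
    show "Ck_on m U (lie (X l) (b j k))" "Ck_on m U (lie (Y l) (b j k))" for l
      by (simp_all only: lie_X_Z[abs_def] lie_Y_Z[abs_def]) (intro Ck_intros Zdb Zbb)+
    show "Ck_on m U (lie None (b j k))"
      by (rule Ck_on_cong[OF open_U, of "\<lambda>p. (\<Sum>l\<in>UNIV. b j l p * Zd k (\<gamma> l) p)
            + 2 * \<i> * cnj (\<gamma> k p) * Tw j p + 2 * \<i> * b j k p * N p"])
        (simp add: lie_T_b, intro Ck_intros IH Tw N Zdg)
  qed
  moreover have "Ck_on (Suc m) U (\<gamma> k)" for k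
  proof (rule Ck_SucI[OF \<gamma>_C1])
    show "Ck_on m U (lie (X l) (\<gamma> k))" "Ck_on m U (lie (Y l) (\<gamma> k))" for l
      by (simp_all only: lie_X_Z[abs_def] lie_Y_Z[abs_def]) (intro Ck_intros Zdg Zbg)+
    show "Ck_on m U (lie None (\<gamma> k))"
      by (rule Ck_on_cong[OF open_U, of "\<lambda>q. \<gamma> k q * \<rho> q"]) (simp add: lie_T_\<gamma>, intro Ck_intros IH \<rho>)
  qed
  moreover have "Ck_on (Suc m) U \<tau>"
  proof (rule Ck_SucI[OF \<tau>_C1])
    show "Ck_on m U (lie (X k) \<tau>)" for k
      by (rule Ck_on_cong[OF open_U, of "\<lambda>q. 4 * Im (\<gamma> k q * \<rho> q)"]) (simp add: lie_\<tau>, intro Ck_intros IH \<rho>)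
    show "Ck_on m U (lie (Y k) \<tau>)" for k
      by (rule Ck_on_cong[OF open_U, of "\<lambda>q. - 4 * Re (\<gamma> k q * \<rho> q)"]) (simp add: lie_\<tau>, intro Ck_intros IH \<rho>)
    show "Ck_on m U (lie None \<tau>)"
      by (rule Ck_on_cong[OF open_U, of "\<lambda>q. 2 * Re ((\<rho> q)\<^sup>2)"]) (simp add: lie_\<tau>, intro Ck_intros \<rho>)
  qed
  ultimately show ?case by blast
qed

lemma w_smooth: "Ck_on m U (w j)"
  using structure_functions_Ck[of m] by blast

lemma lam_smooth: "Ck_on m U lam"
proof -
  define k :: 'n where "k = undefined"
  have e: "Re (\<Sum>j\<in>UNIV. cnj (b j k q) * b j k q) = lam q" if "q \<in> U" for q
    by (simp only: herm_b[OF that] if_True refl Re_complex_of_real)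
  have "Ck_on m U (\<lambda>q. Re (\<Sum>j\<in>UNIV. cnj (b j k q) * b j k q))"
    by (intro Ck_intros structure_functions_Ck[THEN conjunct2, THEN conjunct1, rule_format])
  from Ck_on_cong[OF open_U e this] show ?thesis .
qed

end

section \<open>Conformal maps are contact CR maps\<close>

text \<open>Read \<open>v l\<close> as the columns of a real matrix that is orthogonal up to the factor \<open>\<mu>\<close> and symplectic
  up to the factor \<open>r\<close>. The vector \<open>i v (Inl k) - (r/\<mu>) v (Inr k)\<close> is orthogonal to all columns,
  which form a basis; hence it vanishes, and comparing lengths gives \<open>r = \<mu>\<close>.\<close>

lemma conformal_symplectic_frame:
  fixes v :: "'n::finite + 'n \<Rightarrow> 'n \<Rightarrow> complex"
  assumes re: "\<And>k l. (\<Sum>j\<in>UNIV. Re (cnj (v k j) * v l j)) = (if k = l then \<mu> else 0)"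
    and im: "\<And>k l. 4 * (\<Sum>j\<in>UNIV. Im (cnj (v k j) * v l j)) = - bracket (Some k) (Some l) * r"
    and pos: "\<mu> > 0" "r > 0"
  shows "v (Inr k) j = \<i> * v (Inl k) j" and "\<mu> = r"
proof -
  define A :: "real^('n + 'n)^('n + 'n)" where
    "A = (\<chi> l m. case m of Inl j \<Rightarrow> Re (v l j) | Inr j \<Rightarrow> Im (v l j))"
  have "A ** transpose A = \<mu> *\<^sub>R mat 1"
    using re by (simp add: vec_eq_iff matrix_matrix_mult_def transpose_def A_def sum_UNIV_sum mat_def
        sum.distrib)
  then have "A ** ((1/\<mu>) *\<^sub>R transpose A) = mat 1"
    using pos by (simp add: vec_eq_iff matrix_matrix_mult_def mat_def sum_divide_distrib[symmetric])
  then have inv: "((1/\<mu>) *\<^sub>R transpose A) ** A = mat 1" by (simp add: matrix_left_right_inverse)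
  have nondegenerate: "x = (\<lambda>j. 0)" if x: "\<And>l. (\<Sum>j\<in>UNIV. Re (cnj (v l j) * x j)) = 0" for x
  proof -
    define y :: "real^('n + 'n)" where "y = (\<chi> m. case m of Inl j \<Rightarrow> Re (x j) | Inr j \<Rightarrow> Im (x j))"
    have "A *v y = 0"
      using x by (simp add: vec_eq_iff matrix_vector_mult_def A_def y_def sum_UNIV_sum sum.distrib)
    then have "y = 0"
      by (metis inv matrix_vector_mul_assoc matrix_vector_mul_lid matrix_vector_mult_0_right)
    then have "y $ Inl j = 0" "y $ Inr j = 0" for j by simp_all
    then show ?thesis by (auto simp: y_def complex_eq_iff)
  qed
  have "(\<lambda>j. \<i> * v (Inl k) j - of_real (r / \<mu>) * v (Inr k) j) = (\<lambda>j. 0)" for k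
  proof (rule nondegenerate)
    fix l
    have "Re (cnj (v l j) * (\<i> * v (Inl k) j - of_real (r / \<mu>) * v (Inr k) j))
        = - Im (cnj (v l j) * v (Inl k) j) - (r / \<mu>) * Re (cnj (v l j) * v (Inr k) j)" for j
      by (simp add: algebra_simps add_divide_distrib)
    then have "(\<Sum>j\<in>UNIV. Re (cnj (v l j) * (\<i> * v (Inl k) j - of_real (r / \<mu>) * v (Inr k) j)))
        = - (\<Sum>j\<in>UNIV. Im (cnj (v l j) * v (Inl k) j))
          - (r / \<mu>) * (\<Sum>j\<in>UNIV. Re (cnj (v l j) * v (Inr k) j))"
      by (simp only: sum_subtractf sum_negf sum_distrib_left)
    also have "(\<Sum>j\<in>UNIV. Im (cnj (v l j) * v (Inl k) j)) = - bracket (Some l) (Some (Inl k)) * r / 4"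
      using im[of l "Inl k"] by linarith
    also have "(\<Sum>j\<in>UNIV. Re (cnj (v l j) * v (Inr k) j)) = (if l = Inr k then \<mu> else 0)"
      by (rule re)
    finally have e: "(\<Sum>j\<in>UNIV. Re (cnj (v l j) * (\<i> * v (Inl k) j - of_real (r / \<mu>) * v (Inr k) j)))
        = - (- bracket (Some l) (Some (Inl k)) * r / 4) - (r / \<mu>) * (if l = Inr k then \<mu> else 0)" .
    show "(\<Sum>j\<in>UNIV. Re (cnj (v l j) * (\<i> * v (Inl k) j - of_real (r / \<mu>) * v (Inr k) j))) = 0"
      unfolding e using pos by (cases l) auto
  qed
  then have CR: "\<i> * v (Inl k) j = of_real (r / \<mu>) * v (Inr k) j" for k j
    by (simp add: fun_eq_iff)
  have "\<mu> = (\<Sum>j\<in>UNIV. Re (cnj (\<i> * v (Inl k) j) * (\<i> * v (Inl k) j)))"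
    using re[of "Inl k" "Inl k"] by simp
  also have "\<dots> = (r / \<mu>)\<^sup>2 * (\<Sum>j\<in>UNIV. Re (cnj (v (Inr k) j) * v (Inr k) j))"
    unfolding CR sum_distrib_left by (intro sum.cong) (auto simp: power2_eq_square algebra_simps add_divide_distrib)
  also have "\<dots> = (r / \<mu>)\<^sup>2 * \<mu>" using re[of "Inr k" "Inr k"] by simp
  finally have "r\<^sup>2 = \<mu>\<^sup>2" using pos by (simp add: power_divide field_simps power2_eq_square)
  then show "\<mu> = r" using pos by (simp add: power2_eq_iff)
  then show "v (Inr k) j = \<i> * v (Inl k) j" using CR[of k j] pos by simp
qed

text \<open>The coordinates of a contact map \<open>F\<close>. The hypothesis \<open>lie_ft\<close> is the equation
  \<open>F^* \<alpha> = lam \<alpha>\<close> evaluated on the fields, solved for the derivatives of the last coordinate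
  \<open>ft\<close>.\<close>

locale contact_functions = heis_region U for U :: "('n::finite) heis set" +
  fixes w :: "'n \<Rightarrow> 'n heis \<Rightarrow> complex" and ft lam :: "'n heis \<Rightarrow> real"
  assumes w_C2: "Ck_on (Suc (Suc 0)) U (w j)"
    and ft_C2: "Ck_on (Suc (Suc 0)) U ft"
    and lie_ft: "p \<in> U \<Longrightarrow> lie i ft p = (if i = None then lam p else 0)
      - 2 * (\<Sum>j\<in>UNIV. Im (cnj (w j p) * lie i (w j) p))"
begin

lemma w_C1: "C1 (w j)" and ft_C1: "C1 ft"
  using Ck_on_SucD[OF w_C2] Ck_on_SucD[OF ft_C2] by auto

lemma lie_w_C1: "C1 (lie i (w j))" and lie_ft_C1: "C1 (lie i ft)"
  using w_C2[of j] ft_C2 unfolding Ck_on_Suc_lie[OF open_U, of "Suc 0"] by blast+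

lemma lam_C1: "C1 lam"
proof (rule C1_cong)
  show "C1 (\<lambda>p. lie None ft p + 2 * (\<Sum>j\<in>UNIV. Im (cnj (w j p) * lie None (w j) p)))"
    by (intro Ck_intros w_C1 lie_w_C1 lie_ft_C1)
qed (simp add: lie_ft)

text \<open>The exterior derivative of \<open>F^* \<alpha> = lam \<alpha>\<close>, evaluated on two fields. It is obtained as the
  condition that the derivatives of \<open>ft\<close> prescribed by \<open>lie_ft\<close> satisfy the commutator relations.\<close>

lemma contact_brackets:
  assumes p: "p \<in> U"
  shows "4 * (\<Sum>m\<in>UNIV. Im (cnj (lie i (w m) p) * lie j (w m) p))
    = (if j = None then lie i lam p else 0) - (if i = None then lie j lam p else 0) - bracket i j * lam p"
proof -
  define S where "S i j = (\<Sum>m\<in>UNIV. Im (cnj (w m p) * lie i (lie j (w m)) p))" for i j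
  define B where "B i j = (\<Sum>m\<in>UNIV. Im (cnj (lie i (w m) p) * lie j (w m) p))" for i j
  have LL: "lie i (lie j ft) p = (if j = None then lie i lam p else 0) - 2 * (S i j + B i j)" for i j
  proof -
    have "lie i (lie j ft) p
        = lie i (\<lambda>q. (if j = None then 1 else 0) * lam q - 2 * (\<Sum>m\<in>UNIV. Im (cnj (w m q) * lie j (w m) q))) p"
      by (rule lie_cong[OF open_U p]) (simp add: lie_ft)
    also have "\<dots> = (if j = None then lie i lam p else 0)
        - 2 * (\<Sum>m\<in>UNIV. Im (cnj (w m p) * lie i (lie j (w m)) p + cnj (lie i (w m) p) * lie j (w m) p))"
      using p by (simp add: lie_diff lie_cmult lie_sum lie_Im lie_Re lie_mult lie_cnj Ck_intros w_C1 lie_w_C1 lam_C1)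
        (simp add: algebra_simps)
    finally show ?thesis by (simp only: S_def B_def sum.distrib[symmetric] plus_complex.sel)
  qed
  have S: "S i j = S j i + bracket i j * (\<Sum>m\<in>UNIV. Im (cnj (w m p) * lie None (w m) p))"
    unfolding S_def commutator[OF w_C1 lie_w_C1 p, where i = i and j = j]
      sum_distrib_left sum.distrib[symmetric]
    by (intro sum.cong) (simp_all add: algebra_simps)
  have B: "B j i = - B i j"
    unfolding B_def by (simp add: sum_negf[symmetric] algebra_simps)
  have "lie i (lie j ft) p = lie j (lie i ft) p + bracket i j * lie None ft p"
    using commutator[OF ft_C1 lie_ft_C1 p, of i j] by simp
  then show ?thesis
    unfolding LL S B lie_ft[OF p] B_def[symmetric] by (simp add: algebra_simps)
qed

lemma cr_contact_if_orthogonal: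
  assumes "\<And>p. p \<in> U \<Longrightarrow> lam p > 0" and "\<And>p. p \<in> U \<Longrightarrow> \<mu> p > 0"
    and orth: "\<And>p k l. p \<in> U \<Longrightarrow> (\<Sum>j\<in>UNIV. Re (cnj (lie (Some k) (w j) p) * lie (Some l) (w j) p))
      = (if k = l then \<mu> p else 0)"
  shows "cr_contact U w lam"
proof
  have im: "4 * (\<Sum>j\<in>UNIV. Im (cnj (lie (Some k) (w j) p) * lie (Some l) (w j) p))
      = - bracket (Some k) (Some l) * lam p" if "p \<in> U" for p k l
    using contact_brackets[OF that, of "Some k" "Some l"] by simp
  have CR: "lie (Y k) (w j) p = \<i> * lie (X k) (w j) p" "\<mu> p = lam p" if "p \<in> U" for p k j
    using conformal_symplectic_frame[OF orth[OF that] im[OF that] assms(2,1)[OF that]] by auto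
  fix p assume p: "p \<in> U"
  show "lie (Y k) (w j) p = \<i> * lie (X k) (w j) p" for k j by (rule CR[OF p])
  show "(\<Sum>j\<in>UNIV. cnj (lie (X k) (w j) p) * lie (X l) (w j) p) = (if k = l then complex_of_real (lam p) else 0)"
    for k l
  proof (rule complex_eqI)
    show "Re (\<Sum>j\<in>UNIV. cnj (lie (X k) (w j) p) * lie (X l) (w j) p)
        = Re (if k = l then complex_of_real (lam p) else 0)"
      unfolding Re_sum orth[OF p] using CR(2)[OF p] by simp
    show "Im (\<Sum>j\<in>UNIV. cnj (lie (X k) (w j) p) * lie (X l) (w j) p)
        = Im (if k = l then complex_of_real (lam p) else 0)"
      using im[OF p, of "Inl k" "Inl l"] unfolding Im_sum by simp
  qed
  show "lie (Some i) lam p = 4 * (\<Sum>j\<in>UNIV. Im (cnj (lie (Some i) (w j) p) * lie None (w j) p))" for i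
    using contact_brackets[OF p, of "Some i" None] by simp
qed (use assms(1) w_C2 lam_C1 in auto)

lemma ft_smooth:
  assumes w: "\<And>m j. Ck_on m U (w j)" and lam: "\<And>m. Ck_on m U lam"
  shows "Ck_on m U ft"
proof (cases m)
  case 0
  then show ?thesis using Ck_on_SucD[OF ft_C1] by simp
next
  case (Suc k)
  have ldw: "Ck_on k U (lie i (w j))" for i j
    using w[of "Suc k" j] unfolding Ck_on_Suc_lie[OF open_U] by blast
  have "Ck_on k U (lie i ft)" for i
  proof (rule Ck_on_cong[OF open_U])
    show "Ck_on k U (\<lambda>p. (if i = None then 1 else 0) * lam p
        - 2 * (\<Sum>j\<in>UNIV. Im (cnj (w j p) * lie i (w j) p)))"
      by (intro Ck_intros w lam ldw)
  qed (simp add: lie_ft)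
  then show ?thesis
    unfolding Suc Ck_on_Suc_lie[OF open_U] using C1_differentiable[OF ft_C1] by blast
qed

end

lemma lie_linear:
  assumes "bounded_linear h" "F differentiable (at p)"
  shows "lie i (\<lambda>q. h (F q)) p = h (frechet_derivative F (at p) (lfield i p))"
  by (rule has_lie_eq[OF has_lie_linear[OF assms(1) differentiable_has_lie[OF assms(2)]]])

lemma contact_form_lfield: "contact_form p (lfield i p) = (if i = None then 1 else 0)"
  by (cases p) (auto simp: contact_form_def lfield_def hframe_def axis_def if_distrib
      split: option.splits sum.splits cong: if_cong)

theorem theorem1p1:
  fixes U U' :: "('n::finite) heis set" and F :: "'n heis \<Rightarrow> 'n heis"
  assumes "heis_domain U" and "heis_domain U'"
    and "conformal_map U U' F"
    and "Ck_on 2 U F"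
  shows "Cinf_on U F"
proof -
  have open_U: "open U" using assms(1) by (simp add: heis_domain_def)
  have F_C2: "Ck_on (Suc (Suc 0)) U F" using assms(4) by (simp add: numeral_2_eq_2)
  have Fd: "F differentiable (at p)" if "p \<in> U" for p
    using C1_differentiable[OF Ck_on_SucD[OF F_C2] that] .
  obtain lam where lam: "\<And>p. p \<in> U \<Longrightarrow> lam p > 0"
    "\<And>p v. p \<in> U \<Longrightarrow> contact_form (F p) (frechet_derivative F (at p) v) = lam p * contact_form p v"
    using assms(3) unfolding conformal_map_def contact_diffeo_def pullback_form_def by blast
  define f where "f l q = hcoord l (F q)" for l q
  define w where "w j q = complex_of_real (f (Inl j) q) + \<i> * of_real (f (Inr j) q)" for j q
  define ft where "ft q = snd (snd (F q))" for q
  have bl: "bounded_linear (\<lambda>v. snd (snd v) :: real)"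
    using bounded_linear_compose[OF bounded_linear_snd bounded_linear_snd] by simp
  have f_C2: "Ck_on (Suc (Suc 0)) U (f l)" for l
    unfolding f_def[abs_def] by (rule Ck_on_linear[OF bounded_linear_hcoord open_U F_C2])
  interpret heis_region U by standard (rule open_U)
  have f_C1: "C1 (f l)" for l by (rule Ck_on_SucD[OF f_C2])
  have lie_f: "lie i (f l) p = hcoord l (frechet_derivative F (at p) (lfield i p))" if "p \<in> U" for i l p
    unfolding f_def[abs_def] by (rule lie_linear[OF bounded_linear_hcoord Fd[OF that]])
  have lie_w: "lie i (w j) p = of_real (lie i (f (Inl j)) p) + \<i> * of_real (lie i (f (Inr j)) p)"
    if "p \<in> U" for i j p
    unfolding w_def[abs_def] using that
    by (simp add: lie_add lie_cmult lie_of_real Ck_intros f_C1)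
  interpret contact_functions U w ft lam
  proof
    show "Ck_on (Suc (Suc 0)) U (w j)" for j
      unfolding w_def[abs_def] by (intro Ck_intros f_C2)
    show "Ck_on (Suc (Suc 0)) U ft"
      unfolding ft_def[abs_def] by (rule Ck_on_linear[OF bl open_U F_C2])
    fix p i assume p: "p \<in> U"
    define v where "v = frechet_derivative F (at p) (lfield i p)"
    have "contact_form (F p) v = snd (snd v) + 2 * (\<Sum>j\<in>UNIV. f (Inl j) p * hcoord (Inr j) v - f (Inr j) p * hcoord (Inl j) v)"
      by (cases v, cases "F p") (simp add: contact_form_def hcoord_def f_def)
    moreover have "contact_form (F p) v = (if i = None then lam p else 0)"
      using lam(2)[OF p, of "lfield i p"] by (simp add: v_def contact_form_lfield)
    moreover have "snd (snd v) = lie i ft p"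
      unfolding ft_def[abs_def] lie_linear[OF bl Fd[OF p]] v_def ..
    moreover have "f (Inl j) p * hcoord (Inr j) v - f (Inr j) p * hcoord (Inl j) v
        = Im (cnj (w j p) * lie i (w j) p)" for j
      by (simp add: lie_w[OF p] lie_f[OF p] w_def v_def)
    ultimately show "lie i ft p = (if i = None then lam p else 0)
        - 2 * (\<Sum>j\<in>UNIV. Im (cnj (w j p) * lie i (w j) p))"
      by simp
  qed
  interpret cr_contact U w lam
  proof (rule cr_contact_if_orthogonal)
    show "lam p > 0" if "p \<in> U" for p by (rule lam(1)[OF that])
    show "J0 F p powr (1 / real CARD('n)) > 0" if "p \<in> U" for p
      using assms(3) that by (auto simp: conformal_map_def)
    fix p k l assume p: "p \<in> U"
    have D0: "D0 F p $ m $ i = lie (Some i) (f m) p" for m i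
      using lie_frechet[OF C1_differentiable[OF f_C1[of m] p], where i = "Some i"]
      by (simp add: D0_def hderiv_def f_def[abs_def] lfield_def)
    have "transpose (D0 F p) ** D0 F p = (J0 F p powr (1 / real CARD('n))) *\<^sub>R mat 1"
      using assms(3) p by (simp add: conformal_map_def)
    then have "(transpose (D0 F p) ** D0 F p) $ k $ l = (if k = l then J0 F p powr (1 / real CARD('n)) else 0)"
      by (simp add: mat_def)
    then show "(\<Sum>j\<in>UNIV. Re (cnj (lie (Some k) (w j) p) * lie (Some l) (w j) p))
        = (if k = l then J0 F p powr (1 / real CARD('n)) else 0)"
      by (simp add: matrix_matrix_mult_def transpose_def D0 sum_UNIV_sum lie_w[OF p] sum.distrib)
  qed
  have "Ck_on m U F" for m
  proof (rule Ck_on_cong[OF open_U])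
    have "Ck_on m U (\<lambda>q. Re (w j q))" "Ck_on m U (\<lambda>q. Im (w j q))" for j
      by (intro Ck_intros w_smooth)+
    then have f: "Ck_on m U (f l)" for l
      by (cases l) (simp_all add: w_def)
    show "Ck_on m U (\<lambda>q. (\<Sum>l\<in>UNIV. f l q *\<^sub>R lfield (Some l) 0) + ft q *\<^sub>R lfield None 0)"
      by (intro Ck_intros f ft_smooth w_smooth lam_smooth)
  next
    fix q
    have "contact_form 0 v = snd (snd v)" for v :: "'n heis"
      by (cases v) (simp add: contact_form_def zero_prod_def)
    then show "(\<Sum>l\<in>UNIV. f l q *\<^sub>R lfield (Some l) 0) + ft q *\<^sub>R lfield None 0 = F q"
      using heis_expand[of "F q" 0] by (simp add: f_def ft_def)
  qed
  then show ?thesis by (simp add: Cinf_on_def)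
qed

end
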